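(* Let $\mathcal{V}$ be a Euclidean Jordan algebra of rank $n$ carrying the trace inner product, and let $T:\mathcal{V}\to\mathcal{V}$ be a linear map. Then there exists a unique vector $\eta(T)\in(\mathcal{R}^n_+)^{\downarrow}$ such that $$\lambda(|T(x)|)\prec_w \eta(T)*\lambda(|x|)\quad\text{for all } x\in\mathcal{V},$$ with the additional property that if $q\in(\mathcal{R}^n_+)^{\downarrow}$ satisfies $\lambda(|T(x)|)\prec_w q*\lambda(|x|)$ for all $x\in\mathcal{V}$, then $\eta(T)\prec_w q$.
   Context: A Euclidean Jordan algebra $(\mathcal{V},\circ,\langle\cdot,\cdot\rangle)$ is a finite-dimensional real inner product space with a bilinear commutative product $\circ$ satisfying the Jordan identity $x\circ(x^2\circ y)=x^2\circ(x\circ y)$ (with $x^2=x\circ x$) and $\langle x\circ y,z\rangle=\langle x,y\circ z\rangle$ for all $x,y,z$, with unit element $e$. If $\mathcal{V}$ has rank $n$, every $x\in\mathcal{V}$ has a spectral decomposition $x=\sum_{i=1}^n x_ie_i$ with $\{e_1,\dots,e_n\}$ a Jordan frame (mutually orthogonal primitive idempotents summing to $e$) and $x_i\in\mathbb{R}$ the eigenvalues of $x$ (uniquely determined up to order). Here $\operatorname{tr}(x)=\sum_i x_i$, and the inner product is the trace inner product $\langle x,y\rangle=\operatorname{tr}(x\circ y)$. The eigenvalue vector $\lambda(x)\in\mathbb{R}^n$ is the vector of eigenvalues of $x$ in decreasing order, and $|x|:=\sum_i|x_i|e_i$. $\mathcal{R}^n_+$ is the set of nonnegative vectors in $\mathbb{R}^n$;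 $(\mathcal{R}^n_+)^{\downarrow}$ is the set of $q\in\mathcal{R}^n_+$ with $q_1\ge q_2\ge\cdots\ge q_n$. $p*q$ is the componentwise product. $p^\downarrow$ is the decreasing rearrangement of $p$. For $p,q\in\mathbb{R}^n$, $p\prec_w q$ (weak majorization) means $\sum_{i=1}^k p_i^\downarrow\le\sum_{i=1}^k q_i^\downarrow$ for all $1\le k\le n$. *)

theory Defs
  imports "HOL-Analysis.Analysis"
begin

(* The product of the algebra is written x * y and its unit e is written 1; the product
   need not be associative.  Linearity in the second argument follows from commutativity. *)
class euclidean_jordan_algebra = euclidean_space + power +
  assumes jordan_add_left: "(x + y) * z = x * z + y * z"
    and jordan_scaleR_left: "(r *\<^sub>R x) * y = r *\<^sub>R (x * y)"
    and jordan_commute: "x * y = y * x"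
    and jordan_identity: "x * ((x * x) * y) = (x * x) * (x * y)"
    and inner_jordan_assoc: "inner (x * y) z = inner x (y * z)"
    and jordan_unit: "1 * x = x"

(* The degree of the minimal polynomial of x: the least d for which some monic polynomial
   of degree d annihilates x. *)
definition jdegree :: "'a::euclidean_jordan_algebra \<Rightarrow> nat" where
  "jdegree x = (LEAST d. x ^ d \<in> span ((\<lambda>i. x ^ i) ` {..<d}))"

definition jrank :: "'a::euclidean_jordan_algebra itself \<Rightarrow> nat" where
  "jrank _ = Max (range (jdegree :: 'a \<Rightarrow> nat))"

definition idempotent :: "'a::euclidean_jordan_algebra \<Rightarrow> bool" where
  "idempotent c \<longleftrightarrow> c * c = c"

definition primitive_idempotent :: "'a::euclidean_jordan_algebra \<Rightarrow> bool" where
  "primitive_idempotent c \<longleftrightarrow> idempotent c \<and> c \<noteq> 0 \<and>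
     \<not> (\<exists>a b. idempotent a \<and> idempotent b \<and> a \<noteq> 0 \<and> b \<noteq> 0 \<and> c = a + b)"

definition jordan_frame :: "'a::euclidean_jordan_algebra list \<Rightarrow> bool" where
  "jordan_frame es \<longleftrightarrow>
     (\<forall>c\<in>set es. primitive_idempotent c) \<and>
     (\<forall>i<length es. \<forall>j<length es. i \<noteq> j \<longrightarrow> es ! i * es ! j = 0) \<and>
     sum_list es = 1"

definition spectral_decomposition ::
  "'a::euclidean_jordan_algebra \<Rightarrow> real list \<Rightarrow> 'a list \<Rightarrow> bool" where
  "spectral_decomposition x xs es \<longleftrightarrow> jordan_frame es \<and> length xs = length es \<and>
     x = (\<Sum>i<length es. (xs ! i) *\<^sub>R (es ! i))"

(* Vectors of R^n are real lists of length n, since n is the rank of the algebra and not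
   a type.  Existence and uniqueness of the values described below, and the fact
   that they have length n, are the spectral theorem. *)
definition eigenvalues :: "'a::euclidean_jordan_algebra \<Rightarrow> real list" where
  "eigenvalues x = (THE xs. sorted_wrt (\<ge>) xs \<and> (\<exists>es. spectral_decomposition x xs es))"

definition jtrace :: "'a::euclidean_jordan_algebra \<Rightarrow> real" where
  "jtrace x = sum_list (eigenvalues x)"

definition jabs :: "'a::euclidean_jordan_algebra \<Rightarrow> 'a" where
  "jabs x = (THE y. \<exists>xs es. spectral_decomposition x xs es \<and>
     y = (\<Sum>i<length es. \<bar>xs ! i\<bar> *\<^sub>R (es ! i)))"

definition nonneg_decreasing :: "nat \<Rightarrow> real list set" where
  "nonneg_decreasing n = {q. length q = n \<and> (\<forall>t\<in>set q. 0 \<le> t) \<and> sorted_wrt (\<ge>) q}"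

definition decreasing_rearrangement :: "real list \<Rightarrow> real list" where
  "decreasing_rearrangement p = rev (sort p)"

definition componentwise_product :: "real list \<Rightarrow> real list \<Rightarrow> real list"
    (infixl "\<star>" 70) where
  "p \<star> q = map2 (*) p q"

definition weakly_majorized :: "real list \<Rightarrow> real list \<Rightarrow> bool" (infix "\<prec>\<^sub>w" 50) where
  "p \<prec>\<^sub>w q \<longleftrightarrow> length p = length q \<and>
     (\<forall>k\<in>{1..length p}. sum_list (take k (decreasing_rearrangement p))
        \<le> sum_list (take k (decreasing_rearrangement q)))"

end

theory Submission
  imports Defs
begin

text \<open>Write \<open>ky_fan k y\<close> for the sum of the \<open>k\<close> largest eigenvalues of \<open>|y|\<close>. Comparing decreasing
lists by weak majorization means comparing partial sums, so \<open>q\<close> satisfies the majorization for \<open>T\<close>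
iff \<open>ky_fan k (T x)\<close> is at most the sum of the first \<open>k\<close> products \<open>q\<^sub>i \<lambda>\<^sub>i(|x|)\<close>, for all \<open>x\<close>
and \<open>k\<close>. Two facts turn this into a condition on the partial sums of \<open>q\<close> alone. First,
\<open>ky_fan k\<close> is sublinear, being the maximum of the linear functionals \<open>\<lambda>y. inner y z\<close> over the
signed sums \<open>z\<close> of \<open>k\<close> members of a Jordan frame (\<open>ky_fan_attained\<close>, \<open>ky_fan_upper\<close>). Second,
summation by parts writes each \<open>x\<close> as a nonnegative combination of signed sums of \<open>1, 2, \<dots>, n\<close>
frame members, with the gaps between consecutive eigenvalues of \<open>|x|\<close> as coefficients
(\<open>signed_sum_decomposition\<close>). Hence the majorization holds for all \<open>x\<close> as soon as it holds for
signed sums, where it says that the partial sum of \<open>q\<close> of length \<open>min k m\<close> is at least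
\<open>ky_fan k (T z)\<close> for every signed sum \<open>z\<close> of \<open>m\<close> members (\<open>majorant_iff_signed_sums\<close>).

A decreasing nonnegative \<open>q\<close> is the same thing as a concave increasing sequence of partial sums
starting at \<open>0\<close>. The admissible \<open>q\<close> are thus given by lower bounds on such a sequence; these
conditions and concavity survive pointwise infima, so the pointwise infimum of all admissible
sequences is the least one, and its increments form \<open>\<eta>(T)\<close> (\<open>least_concave_partial_sums\<close>).
Uniqueness holds because weak majorization is antisymmetric on decreasing lists.

Beneath this lies the spectral theorem. Complete systems of orthogonal idempotents come from
eigenvectors of multiplication by \<open>x\<close> inside the span of the powers of \<open>x\<close>, and a system with as
many members as possible is primitive. That eigenvalues and the length of a frame do not depend
on the frame rests on a computation for primitive idempotents: if \<open>e\<close> and \<open>f\<close> are primitive then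
\<open>2 * |e * f|\<^sup>2 = inner e f * (1 + inner e f / |e|\<^sup>2)\<close>, whose symmetry forces \<open>|e| = |f|\<close> unless
\<open>inner e f = 0\<close>. Therefore the matrix \<open>inner c d / |c|\<^sup>2\<close> between two frames is doubly stochastic,
which lets one count eigenvalues in either frame (\<open>spectral_values_unique\<close>).\<close>

section \<open>The product as a bilinear map and the linearised Jordan identity\<close>

lemma jordan_add_right: "x * (y + z) = x * y + x * (z :: 'a::euclidean_jordan_algebra)"
  by (metis jordan_add_left jordan_commute)

lemma jordan_scaleR_right: "x * (r *\<^sub>R y) = r *\<^sub>R (x * (y :: 'a::euclidean_jordan_algebra))"
  by (metis jordan_scaleR_left jordan_commute)

interpretation jordan: bounded_bilinear "(*) :: 'a::euclidean_jordan_algebra \<Rightarrow> 'a \<Rightarrow> 'a"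
proof -
  have "bilinear ((*) :: 'a \<Rightarrow> 'a \<Rightarrow> 'a)"
    unfolding bilinear_def
    by (auto intro!: linearI simp: jordan_add_left jordan_add_right jordan_scaleR_left
        jordan_scaleR_right)
  then show "bounded_bilinear ((*) :: 'a \<Rightarrow> 'a \<Rightarrow> 'a)"
    by (simp add: bilinear_conv_bounded_bilinear)
qed

declare jordan.zero_left [simp] jordan.zero_right [simp]

lemma jordan_unit_right: "x * 1 = (x :: 'a::euclidean_jordan_algebra)"
  by (metis jordan_unit jordan_commute)

lemma jordan_self_adjoint: "inner (a * y) z = inner y (a * (z :: 'a::euclidean_jordan_algebra))"
  by (metis inner_jordan_assoc jordan_commute)

text \<open>The part of the Jordan identity that is linear in \<open>y\<close>, after replacing \<open>x\<close> by \<open>x + y\<close>. It is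
isolated by the combination \<open>J(x + y) - J(x - y) - 2 J(y)\<close>, which removes the parts of degree
\<open>0\<close>, \<open>2\<close> and \<open>3\<close> in \<open>y\<close>.\<close>

lemma jordan_linearised:
  fixes x y w :: "'a::euclidean_jordan_algebra"
  shows "y * ((x * x) * w) + 2 *\<^sub>R (x * ((x * y) * w)) = (x * x) * (y * w) + 2 *\<^sub>R ((x * y) * (x * w))"
proof -
  have c: "y * x = x * y" by (rule jordan_commute)
  note ex = jordan.add_left jordan.add_right jordan.diff_left jordan.diff_right c
  have "2 *\<^sub>R (y * ((x * x) * w) + 2 *\<^sub>R (x * ((x * y) * w))) =
    ((x + y) * (((x + y) * (x + y)) * w) - (x - y) * (((x - y) * (x - y)) * w)) - 2 *\<^sub>R (y * ((y * y) * w))"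
    by (simp add: ex algebra_simps scaleR_2)
  also have "\<dots> = (((x + y) * (x + y)) * ((x + y) * w) - ((x - y) * (x - y)) * ((x - y) * w)) - 2 *\<^sub>R ((y * y) * (y * w))"
    by (simp only: jordan_identity)
  also have "\<dots> = 2 *\<^sub>R ((x * x) * (y * w) + 2 *\<^sub>R ((x * y) * (x * w)))"
    by (simp add: ex algebra_simps scaleR_2)
  finally show ?thesis by simp
qed

text \<open>Read as an identity between operators applied to \<open>y\<close>, this expresses multiplication by
\<open>x\<^sup>2 * w\<close> through multiplications by \<open>x\<close>, \<open>x\<^sup>2\<close>, \<open>w\<close> and \<open>x * w\<close>. With \<open>w\<close> a power of \<open>x\<close> it is a
recursion for multiplication by powers; with \<open>w = x\<close> idempotent it is the cubic equation of
the Peirce decomposition.\<close>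

lemma jordan_mult_square:
  fixes x y w :: "'a::euclidean_jordan_algebra"
  shows "((x * x) * w) * y = (x * x) * (w * y) + 2 *\<^sub>R ((x * w) * (x * y)) - 2 *\<^sub>R (x * (w * (x * y)))"
  using jordan_linearised[of y x w]
  by (simp add: jordan_commute[of y w] jordan_commute[of y "(x * x) * w"] jordan_commute[of "x * y"]
      algebra_simps)

text \<open>By the recursion above, multiplication by \<open>x\<^sup>k\<close> is a polynomial in the multiplications by \<open>x\<close>
and by \<open>x\<^sup>2\<close>, which commute by the Jordan identity. This is all of power associativity that
the spectral theorem uses.\<close>

lemma jordan_power_commutes:
  fixes x :: "'a::euclidean_jordan_algebra"
  shows "x ^ k * (x * y) = x * (x ^ k * y)" and "x ^ k * ((x * x) * y) = (x * x) * (x ^ k * y)"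
proof (induction k arbitrary: y rule: induct_nat_012)
  case (ge2 k)
  define p q s where "p = x ^ k" and "q = x ^ Suc k" and "s = x * x"
  have p: "p * (x * z) = x * (p * z)" "p * (s * z) = s * (p * z)" for z
    using ge2(1,2) by (simp_all add: p_def s_def)
  have q: "q * (x * z) = x * (q * z)" "q * (s * z) = s * (q * z)" for z
    using ge2(3,4) unfolding q_def s_def by blast+
  have s: "s * (x * z) = x * (s * z)" for z
    by (simp add: s_def jordan_identity)
  have "x ^ Suc (Suc k) = x * (x * p)" by (simp add: p_def)
  also have "\<dots> = s * p" using p(1)[of x] jordan_commute by (metis s_def)
  finally have pow: "x ^ Suc (Suc k) = s * p" .
  have "q = x * p" by (simp add: p_def q_def)
  then have sp: "(s * p) * z = s * (p * z) + 2 *\<^sub>R (q * (x * z)) - 2 *\<^sub>R (x * (p * (x * z)))" for z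
    using jordan_mult_square[of x p z] by (simp add: s_def)
  { case 1 show ?case unfolding pow
      by (simp add: sp p q s jordan.add_right jordan.diff_right jordan.scaleR_right)
  next
    case 2 show ?case unfolding pow s_def[symmetric]
      by (simp add: sp p q s jordan.add_right jordan.diff_right jordan.scaleR_right)
  }
qed (simp_all add: jordan_unit jordan_identity jordan_unit_right)

section \<open>Idempotents\<close>

text \<open>Multiplication \<open>L\<close> by an idempotent satisfies \<open>L = 3 L\<^sup>2 - 2 L\<^sup>3\<close>: its eigenvalues are among
\<open>0\<close>, \<open>1/2\<close> and \<open>1\<close>.\<close>

lemma idempotent_peirce:
  fixes e y :: "'a::euclidean_jordan_algebra"
  assumes "idempotent e"
  shows "e * y = 3 *\<^sub>R (e * (e * y)) - 2 *\<^sub>R (e * (e * (e * y)))"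
proof -
  have [simp]: "e * e = e" using assms by (simp add: idempotent_def)
  have "e * y = e * (e * y) + 2 *\<^sub>R (e * (e * y)) - 2 *\<^sub>R (e * (e * (e * y)))"
    using jordan_mult_square[of e e y] by simp
  also have "e * (e * y) + 2 *\<^sub>R (e * (e * y)) = 3 *\<^sub>R (e * (e * y))"
    using scaleR_add_left[of 1 2 "e * (e * y)"] by simp
  finally show ?thesis .
qed

text \<open>This makes multiplication \<open>L\<close> by an idempotent visibly positive semidefinite. It is the
identity \<open>L = L\<^sup>2 + 4 (L - L\<^sup>2)\<^sup>2\<close>, which holds because \<open>t = t\<^sup>2 + 4 (t - t\<^sup>2)\<^sup>2\<close> at
\<open>t = 0, 1/2, 1\<close>.\<close>

lemma idempotent_inner_formula:
  fixes e y :: "'a::euclidean_jordan_algebra"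
  assumes "idempotent e"
  shows "inner (e * y) y = (norm (e * y))\<^sup>2 + 4 * (norm (e * y - e * (e * y)))\<^sup>2"
proof -
  define a b c d where "a = e * y" and "b = e * a" and "c = e * b" and "d = e * c"
  have abc: "a = 3 *\<^sub>R b - 2 *\<^sub>R c" "b = 3 *\<^sub>R c - 2 *\<^sub>R d"
    using idempotent_peirce[OF assms] by (simp_all add: a_def b_def c_def d_def)
  have in1: "inner a a = inner y b" "inner a b = inner y c" "inner b b = inner y d" "inner b a = inner y c"
    by (simp_all add: a_def b_def c_def d_def jordan_self_adjoint)
  have in2: "inner y a = 3 * inner y b - 2 * inner y c"
    by (subst abc(1)) (simp add: inner_diff_right)
  have in3: "inner y b = 3 * inner y c - 2 * inner y d"
    by (subst abc(2)) (simp add: inner_diff_right)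
  have "(norm a)\<^sup>2 + 4 * (norm (a - b))\<^sup>2 = inner y a"
    using in2 in3 by (simp add: power2_norm_eq_inner inner_diff_left inner_diff_right in1)
  then show ?thesis by (simp add: a_def b_def inner_commute)
qed

lemma idempotent_inner_eq_0:
  fixes e y :: "'a::euclidean_jordan_algebra"
  assumes "idempotent e" "inner (e * y) y = 0"
  shows "e * y = 0"
proof -
  have "(norm (e * y))\<^sup>2 = 0"
    using idempotent_inner_formula[OF assms(1), of y] assms(2)
      zero_le_power2[of "norm (e * y)"] zero_le_power2[of "norm (e * y - e * (e * y))"] by linarith
  then show ?thesis by simp
qed

lemma inner_idempotents:
  assumes "idempotent d"
  shows "inner e d = inner (e * d) d"
  using assms by (metis idempotent_def inner_jordan_assoc)

lemma inner_idempotents_nonneg: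
  assumes "idempotent e" "idempotent d"
  shows "0 \<le> inner e d"
  using idempotent_inner_formula[OF assms(1), of d] inner_idempotents[OF assms(2), of e] by simp

text \<open>Orthogonality for the inner product and for the product agree on idempotents, since
\<open>inner e d = inner (e * d) d\<close> is the quadratic form of a positive semidefinite operator at \<open>d\<close>.\<close>

lemma idempotents_orthogonal_iff:
  assumes "idempotent e" "idempotent d"
  shows "inner e d = 0 \<longleftrightarrow> e * d = 0"
  using idempotent_inner_eq_0[OF assms(1), of d] inner_idempotents[OF assms(2), of e] by auto

lemma idempotent_one: "idempotent (1::'a::euclidean_jordan_algebra)"
  by (simp add: idempotent_def jordan_unit)

lemma inner_idempotent_one:
  assumes "idempotent e"
  shows "inner e 1 = inner e e"
  using assms by (metis idempotent_def inner_jordan_assoc jordan_unit_right)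

lemma idempotent_diff:
  fixes e f :: "'a::euclidean_jordan_algebra"
  assumes "idempotent e" "idempotent f" "e * f = f"
  shows "idempotent (e - f)"
  using assms by (simp add: idempotent_def jordan.diff_left jordan.diff_right jordan_commute[of f e])

lemma idempotent_summands_orthogonal:
  fixes a b :: "'a::euclidean_jordan_algebra"
  assumes "idempotent a" "idempotent b" "idempotent (a + b)"
  shows "a * b = 0"
proof -
  have "2 *\<^sub>R (a * b) = 0"
    using assms unfolding idempotent_def
    by (simp add: jordan.add_left jordan.add_right jordan_commute[of b a] algebra_simps scaleR_2)
  then show ?thesis by simp
qed

section \<open>Complete systems of orthogonal idempotents\<close>

definition orthogonal_idempotents :: "'a::euclidean_jordan_algebra set \<Rightarrow> bool" where
  "orthogonal_idempotents C \<longleftrightarrow> finite C \<and> (\<forall>c\<in>C. idempotent c \<and> c \<noteq> 0) \<and>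
     (\<forall>c\<in>C. \<forall>d\<in>C. c \<noteq> d \<longrightarrow> c * d = 0)"

lemma orthogonal_idempotents_inner:
  fixes C :: "'a::euclidean_jordan_algebra set"
  assumes "orthogonal_idempotents C" "c \<in> C" "d \<in> C"
  shows "inner c d = (if c = d then inner d d else 0)"
  using assms idempotents_orthogonal_iff[of c d] by (auto simp: orthogonal_idempotents_def)

lemma orthogonal_idempotents_card_le:
  fixes C :: "'a::euclidean_jordan_algebra set"
  assumes "orthogonal_idempotents C"
  shows "card C \<le> DIM('a)"
proof -
  have "pairwise orthogonal C"
    using assms idempotents_orthogonal_iff
    unfolding pairwise_def orthogonal_def orthogonal_idempotents_def by blast
  moreover have "0 \<notin> C" using assms by (auto simp: orthogonal_idempotents_def)
  ultimately have "independent C" by (rule pairwise_orthogonal_independent)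
  then show ?thesis using independent_bound by blast
qed

text \<open>A maximiser \<open>w\<close> of the quadratic form of \<open>f\<close> on the unit sphere of \<open>W\<close> is an eigenvector: the
residual \<open>f w - t w\<close> lies in \<open>W\<close>, and moving \<open>w\<close> slightly in that direction would increase the
form to first order.\<close>

lemma self_adjoint_eigenvector:
  fixes f :: "'a::euclidean_space \<Rightarrow> 'a"
  assumes lin: "linear f" and sym: "\<And>u v. inner (f u) v = inner u (f v)"
    and W: "subspace W" and inv: "\<And>w. w \<in> W \<Longrightarrow> f w \<in> W" and ne: "W \<noteq> {0}"
  shows "\<exists>w t. w \<in> W \<and> w \<noteq> 0 \<and> f w = t *\<^sub>R w"
proof -
  define S where "S = W \<inter> sphere 0 1"
  have "closed W" using W by (rule closed_subspace)
  then have "compact S" unfolding S_def by (rule closed_Int_compact) simp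
  obtain w0 where "w0 \<in> W" "w0 \<noteq> 0" using ne subspace_0[OF W] by blast
  then have "(1 / norm w0) *\<^sub>R w0 \<in> S" unfolding S_def by (simp add: subspace_scale[OF W])
  then have "S \<noteq> {}" by blast
  have cont: "continuous_on S (\<lambda>w. inner (f w) w)"
    using lin by (intro continuous_intros linear_continuous_on) (simp add: linear_conv_bounded_linear)
  obtain w where w: "w \<in> S" "\<And>v. v \<in> S \<Longrightarrow> inner (f v) v \<le> inner (f w) w"
    using continuous_attains_sup[OF \<open>compact S\<close> \<open>S \<noteq> {}\<close> cont] by blast
  define t where "t = inner (f w) w"
  have wW: "w \<in> W" and nw: "norm w = 1" using w(1) by (auto simp: S_def)
  have le: "inner (f v) v \<le> t * (norm v)\<^sup>2" if "v \<in> W" for v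
  proof (cases "v = 0")
    case False
    have "(1 / norm v) *\<^sub>R v \<in> S" using False that by (simp add: S_def subspace_scale[OF W])
    from w(2)[OF this] False show ?thesis
      by (simp add: t_def linear_scale[OF lin] field_simps power2_eq_square)
  qed (simp add: linear_0[OF lin])
  define v where "v = f w - t *\<^sub>R w"
  have vW: "v \<in> W" unfolding v_def by (intro subspace_diff W inv wW subspace_scale)
  define b where "b = t * (norm v)\<^sup>2 - inner (f v) v"
  have *: "2 * s * (norm v)\<^sup>2 \<le> s\<^sup>2 * b" for s
  proof -
    have "w + s *\<^sub>R v \<in> W" by (intro subspace_add W wW subspace_scale vW)
    from le[OF this] have "inner (f (w + s *\<^sub>R v)) (w + s *\<^sub>R v) \<le> t * (norm (w + s *\<^sub>R v))\<^sup>2" .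
    moreover have "inner (f (w + s *\<^sub>R v)) (w + s *\<^sub>R v) = t + 2 * s * inner (f w) v + s\<^sup>2 * inner (f v) v"
      using sym[of v w] by (simp add: linear_add[OF lin] linear_scale[OF lin] t_def algebra_simps
        inner_add_left inner_add_right inner_commute power2_eq_square)
    moreover have "(norm (w + s *\<^sub>R v))\<^sup>2 = 1 + 2 * s * inner w v + s\<^sup>2 * (norm v)\<^sup>2"
      unfolding power2_norm_eq_inner using nw
      by (simp add: norm_eq_1 inner_commute algebra_simps inner_add_left inner_add_right
          power2_eq_square)
    moreover have "inner (f w) v - t * inner w v = (norm v)\<^sup>2"
      by (simp add: v_def power2_norm_eq_inner inner_diff_left inner_diff_right algebra_simps)
    ultimately show ?thesis unfolding b_def by (simp add: algebra_simps)
  qed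
  have "v = 0"
  proof (rule ccontr)
    assume "v \<noteq> 0"
    \<comment> \<open>a step so small that the quadratic term cannot compensate the linear one\<close>
    define s where "s = (norm v)\<^sup>2 / (\<bar>b\<bar> + 1)"
    have "s > 0" using \<open>v \<noteq> 0\<close> by (simp add: s_def add_nonneg_pos)
    have "2 * (norm v)\<^sup>2 \<le> s * b" using *[of s] \<open>s > 0\<close> by (simp add: power2_eq_square)
    also have "\<dots> \<le> s * (\<bar>b\<bar> + 1)" using \<open>s > 0\<close> by (intro mult_left_mono) auto
    also have "\<dots> = (norm v)\<^sup>2" by (simp add: s_def)
    finally show False using \<open>v \<noteq> 0\<close> by simp
  qed
  then have "f w = t *\<^sub>R w" by (simp add: v_def)
  then show ?thesis using wW nw by (metis norm_zero zero_neq_one)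
qed

lemma orthogonal_idempotents_mult:
  fixes C :: "'a::euclidean_jordan_algebra set"
  assumes "orthogonal_idempotents C" "d \<in> C"
  shows "(\<Sum>c\<in>C. t c *\<^sub>R c) * d = t d *\<^sub>R d"
proof -
  have "(\<Sum>c\<in>C. t c *\<^sub>R c) * d = (\<Sum>c\<in>C. if c = d then t d *\<^sub>R d else 0)"
    unfolding jordan.sum_left jordan.scaleR_left
    using assms by (intro sum.cong) (auto simp: orthogonal_idempotents_def idempotent_def)
  also have "\<dots> = t d *\<^sub>R d" using assms by (simp add: orthogonal_idempotents_def)
  finally show ?thesis .
qed

lemma orthogonal_idempotents_calculus_mult:
  fixes C :: "'a::euclidean_jordan_algebra set"
  assumes "orthogonal_idempotents C"
  shows "(\<Sum>c\<in>C. t c *\<^sub>R c) * (\<Sum>c\<in>C. s c *\<^sub>R c) = (\<Sum>c\<in>C. (t c * s c) *\<^sub>R c)"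
proof -
  define x where "x = (\<Sum>c\<in>C. t c *\<^sub>R c)"
  have "x * (\<Sum>c\<in>C. s c *\<^sub>R c) = (\<Sum>c\<in>C. s c *\<^sub>R (x * c))"
    by (simp add: jordan.sum_right jordan.scaleR_right)
  also have "\<dots> = (\<Sum>c\<in>C. (t c * s c) *\<^sub>R c)"
    using orthogonal_idempotents_mult[OF assms]
    by (intro sum.cong refl) (simp add: x_def mult.commute)
  finally show ?thesis by (simp add: x_def)
qed

lemma maximal_card_exists:
  assumes "P A" "\<And>B. P B \<Longrightarrow> card B \<le> (N::nat)"
  shows "\<exists>B. P B \<and> (\<forall>B'. P B' \<longrightarrow> card B' \<le> card B)"
proof -
  have "\<forall>B. P B \<longrightarrow> card B < Suc N" using assms(2) by (simp add: less_Suc_eq_le)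
  from ex_has_greatest_nat[of P, OF assms(1) this] show ?thesis .
qed

text \<open>Let \<open>A\<close> be the span of the powers of \<open>x\<close>. An eigenvector \<open>u \<in> A\<close> of multiplication by \<open>x\<close> is an
eigenvector of multiplication by every element of \<open>A\<close>, in particular \<open>u * u\<close> is a multiple of
\<open>u\<close>, and so a multiple of \<open>u\<close> is idempotent. A largest orthogonal system \<open>C\<close> of such idempotents
leaves nothing in \<open>A\<close> orthogonal to it; but \<open>1 - \<Sum>C\<close> is orthogonal to \<open>C\<close>, so \<open>\<Sum>C = 1\<close>, and
multiplying by \<open>x\<close> gives the decomposition.\<close>

lemma spectral_idempotents_exist:
  fixes x :: "'a::euclidean_jordan_algebra"
  shows "\<exists>C t. orthogonal_idempotents C \<and> \<Sum>C = 1 \<and> x = (\<Sum>c\<in>C. t c *\<^sub>R c)"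
proof -
  define A where "A = span (range (\<lambda>k::nat. x ^ k))"
  have A: "subspace A" by (simp add: A_def)
  have one: "1 \<in> A" unfolding A_def by (rule span_base) (metis power_0 rangeI)
  have comm: "u * (x * y) = x * (u * y)" if "u \<in> A" for u y
    using that unfolding A_def
    by (induction rule: span_induct_alt) (auto simp: jordan.add_left jordan.add_right
        jordan.scaleR_left jordan.scaleR_right jordan_power_commutes)
  have xA: "x * u \<in> A" if "u \<in> A" for u
    using that unfolding A_def
  proof (induction rule: span_induct_alt)
    case (step c u y)
    then obtain k where "u = x ^ k" by blast
    then have "x * u \<in> span (range (\<lambda>k. x ^ k))" by (metis power_Suc rangeI span_base)
    then show ?case using step by (simp add: jordan.add_right jordan.scaleR_right span_add span_scale)
  qed (simp add: span_zero)
  define P where "P C \<longleftrightarrow> orthogonal_idempotents C \<and> C \<subseteq> A \<and> (\<forall>c\<in>C. \<exists>t. x * c = t *\<^sub>R c)" for C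
  have "P {}" by (simp add: P_def orthogonal_idempotents_def)
  then obtain C where C: "P C" "\<And>B. P B \<Longrightarrow> card B \<le> card C"
    using maximal_card_exists[of P "{}" "DIM('a)"] orthogonal_idempotents_card_le P_def by metis
  have orth: "orthogonal_idempotents C" and CA: "C \<subseteq> A" and eig: "\<forall>c\<in>C. \<exists>t. x * c = t *\<^sub>R c"
    using C(1) by (auto simp: P_def)
  have idem: "idempotent c" if "c \<in> C" for c using that orth by (auto simp: orthogonal_idempotents_def)
  have fin: "finite C" using orth by (simp add: orthogonal_idempotents_def)
  define W where "W = {w \<in> A. \<forall>c\<in>C. inner w c = 0}"
  have W: "subspace W"
    unfolding W_def
  proof (rule subspaceI)
    show "u + v \<in> {w \<in> A. \<forall>c\<in>C. inner w c = 0}"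
      if "u \<in> {w \<in> A. \<forall>c\<in>C. inner w c = 0}" "v \<in> {w \<in> A. \<forall>c\<in>C. inner w c = 0}" for u v
      using that subspace_add[OF A] by (simp add: inner_add_left)
    show "s *\<^sub>R u \<in> {w \<in> A. \<forall>c\<in>C. inner w c = 0}"
      if "u \<in> {w \<in> A. \<forall>c\<in>C. inner w c = 0}" for s u
      using that subspace_scale[OF A] by simp
  qed (simp add: subspace_0[OF A])
  have invW: "x * w \<in> W" if "w \<in> W" for w
  proof -
    have "inner (x * w) c = 0" if "c \<in> C" for c
    proof -
      from bspec[OF eig that] obtain t where t: "x * c = t *\<^sub>R c" ..
      have "inner w c = 0" using \<open>w \<in> W\<close> that by (simp add: W_def)
      then show ?thesis unfolding jordan_self_adjoint t by simp
    qed
    then show ?thesis using that xA[of w] by (simp add: W_def)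
  qed
  have "W = {0}"
  proof (rule ccontr)
    assume "W \<noteq> {0}"
    have "linear ((*) x)" by (rule bounded_linear.linear[OF jordan.bounded_linear_right])
    from self_adjoint_eigenvector[OF this jordan_self_adjoint W invW \<open>W \<noteq> {0}\<close>]
    obtain u t where u: "u \<in> W" "u \<noteq> 0" "x * u = t *\<^sub>R u" by blast
    have uA: "u \<in> A" using u(1) by (simp add: W_def)
    have "\<exists>s. v * u = s *\<^sub>R u" if "v \<in> A" for v
      using that unfolding A_def
    proof (induction rule: span_induct_alt)
      case base then show ?case by (metis jordan.zero_left scaleR_zero_left)
    next
      case (step c v y)
      then obtain k where k: "v = x ^ k" by blast
      have "\<exists>s. x ^ k * u = s *\<^sub>R u"
      proof (induction k)
        case 0 then show ?case by (metis jordan_unit power_0 scaleR_one)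
      next
        case (Suc k)
        then obtain s where s: "x ^ k * u = s *\<^sub>R u" by blast
        have "x ^ Suc k * u = u * (x * x ^ k)" by (simp add: jordan_commute)
        also have "\<dots> = x * (u * x ^ k)" by (rule comm[OF uA])
        also have "\<dots> = s *\<^sub>R (x * u)" using s by (simp add: jordan_commute jordan.scaleR_right)
        finally show ?case using u(3) by auto
      qed
      then obtain s1 where "v * u = s1 *\<^sub>R u" using k by blast
      moreover obtain s2 where "y * u = s2 *\<^sub>R u" using step by blast
      ultimately have "(c *\<^sub>R v + y) * u = (c * s1 + s2) *\<^sub>R u"
        by (simp add: jordan.add_left jordan.scaleR_left scaleR_add_left)
      then show ?case by blast
    qed
    then obtain s where s: "u * u = s *\<^sub>R u" using uA by blast
    have "inner (u * u) 1 = inner u u" by (simp add: inner_jordan_assoc jordan_unit_right)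
    then have "s \<noteq> 0" using s u(2) by auto
    define c where "c = (1 / s) *\<^sub>R u"
    have cW: "c \<in> W" unfolding c_def using u(1) W by (simp add: subspace_scale)
    have c: "idempotent c" "c \<noteq> 0" "x * c = t *\<^sub>R c"
      using \<open>s \<noteq> 0\<close> u by (simp_all add: c_def idempotent_def jordan.scaleR_left jordan.scaleR_right s)
    have "c * d = 0" "d * c = 0" if "d \<in> C" for d
      using cW that idempotents_orthogonal_iff[OF c(1) idem[OF that]] by (auto simp: W_def jordan_commute)
    then have "P (insert c C)"
      using C(1) c cW unfolding P_def orthogonal_idempotents_def W_def by auto
    moreover have "c \<notin> C" using cW c(2) by (auto simp: W_def)
    ultimately show False using C(2)[of "insert c C"] fin by simp
  qed
  have "1 - \<Sum>C \<in> W"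
  proof -
    have "inner (1 - \<Sum>C) d = 0" if "d \<in> C" for d
    proof -
      have "inner (\<Sum>C) d = (\<Sum>c\<in>C. if c = d then inner d d else 0)"
        unfolding inner_sum_left using orthogonal_idempotents_inner[OF orth _ that]
        by (intro sum.cong) auto
      also have "\<dots> = inner d d" using that fin by simp
      finally show ?thesis
        using inner_idempotent_one[OF idem[OF that]] inner_commute[of 1 d]
        by (simp add: inner_diff_left)
    qed
    then show ?thesis using one CA A by (auto simp: W_def intro!: subspace_diff subspace_sum)
  qed
  then have sum1: "\<Sum>C = 1" using \<open>W = {0}\<close> by simp
  from eig obtain t where t: "\<forall>c\<in>C. x * c = t c *\<^sub>R c" by metis
  have "x = x * \<Sum>C" by (simp add: sum1 jordan_unit_right)
  also have "\<dots> = (\<Sum>c\<in>C. t c *\<^sub>R c)" using t by (simp add: jordan.sum_right)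
  finally show ?thesis using orth sum1 by blast
qed

section \<open>Primitive idempotents\<close>

text \<open>Decompose \<open>z\<close> along a complete orthogonal system \<open>C\<close>. Since \<open>inner (1 - e) (z\<^sup>2) = 0\<close> is a sum
of nonnegative terms, each \<open>c \<in> C\<close> with nonzero coefficient satisfies \<open>(1 - e) * c = 0\<close>. Then
\<open>e = c + (e - c)\<close> splits \<open>e\<close> into idempotents, so primitivity leaves only \<open>c = e\<close>.\<close>

lemma primitive_eigenspace:
  fixes e z :: "'a::euclidean_jordan_algebra"
  assumes e: "primitive_idempotent e" and z: "e * z = z"
  shows "\<exists>t. z = t *\<^sub>R e"
proof -
  obtain C t where C: "orthogonal_idempotents C" and z_eq: "z = (\<Sum>c\<in>C. t c *\<^sub>R c)"
    using spectral_idempotents_exist by blast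
  have idem: "idempotent c" if "c \<in> C" for c
    using C that by (auto simp: orthogonal_idempotents_def)
  have fin: "finite C" using C by (simp add: orthogonal_idempotents_def)
  have ide: "idempotent e" using e by (simp add: primitive_idempotent_def)
  have id1: "idempotent (1 - e)" by (intro idempotent_diff idempotent_one ide jordan_unit)
  have "inner (1 - e) (z * z) = 0"
    using inner_jordan_assoc[of e z z] inner_jordan_assoc[of 1 z z]
    by (simp add: z jordan_unit inner_diff_left)
  moreover have "z * z = (\<Sum>c\<in>C. (t c * t c) *\<^sub>R c)"
    unfolding z_eq by (rule orthogonal_idempotents_calculus_mult[OF C])
  ultimately have "(\<Sum>c\<in>C. (t c * t c) * inner (1 - e) c) = 0" by (simp add: inner_sum_right)
  then have 0: "(t c * t c) * inner (1 - e) c = 0" if "c \<in> C" for c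
    using sum_nonneg_eq_0_iff[OF fin, of "\<lambda>c. (t c * t c) * inner (1 - e) c"]
      inner_idempotents_nonneg[OF id1 idem] that by auto
  have eq: "c = e" if c: "c \<in> C" "t c \<noteq> 0" for c
  proof (rule ccontr)
    assume "c \<noteq> e"
    have "(1 - e) * c = 0"
      using 0[OF c(1)] c(2) idempotents_orthogonal_iff[OF id1 idem[OF c(1)]] by simp
    then have "e * c = c" by (simp add: jordan.diff_left jordan_unit)
    then have "idempotent (e - c)" by (rule idempotent_diff[OF ide idem[OF c(1)]])
    moreover have "c \<noteq> 0" using C c(1) by (auto simp: orthogonal_idempotents_def)
    moreover have "e = c + (e - c)" "e - c \<noteq> 0" using \<open>c \<noteq> e\<close> by auto
    ultimately show False using e idem[OF c(1)] unfolding primitive_idempotent_def by blast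
  qed
  have "z = (\<Sum>c\<in>C. if c = e then t e *\<^sub>R e else 0)"
    unfolding z_eq using eq by (intro sum.cong) auto
  also have "\<dots> = (if e \<in> C then t e else 0) *\<^sub>R e" using fin by simp
  finally show ?thesis by blast
qed

text \<open>With \<open>L\<close> the multiplication by \<open>e\<close>, the operator \<open>2 L\<^sup>2 - L\<close> is the projection onto the
eigenspace of \<open>L\<close> for the eigenvalue \<open>1\<close>, which is spanned by \<open>e\<close>.\<close>

lemma primitive_compression:
  fixes e y :: "'a::euclidean_jordan_algebra"
  assumes e: "primitive_idempotent e"
  shows "2 *\<^sub>R (e * (e * y)) - e * y = (inner e y / inner e e) *\<^sub>R e"
proof -
  have ide: "e * e = e" "idempotent e" "e \<noteq> 0"
    using e by (simp_all add: primitive_idempotent_def idempotent_def)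
  define z where "z = 2 *\<^sub>R (e * (e * y)) - e * y"
  have "e * y + 2 *\<^sub>R (e * (e * (e * y))) = 3 *\<^sub>R (e * (e * y))"
    using idempotent_peirce[OF ide(2), of y] by (simp add: algebra_simps)
  also have "\<dots> = 2 *\<^sub>R (e * (e * y)) + e * (e * y)"
    using scaleR_add_left[of 2 1 "e * (e * y)"] by simp
  finally have "e * z = z"
    by (simp add: z_def jordan.diff_right jordan.scaleR_right algebra_simps)
  then obtain t where t: "z = t *\<^sub>R e" using primitive_eigenspace[OF e] by blast
  have "inner z e = inner y e"
    by (simp add: z_def inner_diff_left jordan_self_adjoint ide(1))
  then have "t = inner e y / inner e e" using t ide(3) inner_commute[of y e] by (simp add: field_simps)
  then show ?thesis using t by (simp add: z_def)
qed

lemma primitive_product_norm: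
  fixes e f :: "'a::euclidean_jordan_algebra"
  assumes e: "primitive_idempotent e" and f: "idempotent f"
  shows "2 * inner (e * f) (e * f) = inner e f * (1 + inner e f / inner e e)"
proof -
  have "2 * inner (e * f) (e * f) = inner f (2 *\<^sub>R (e * (e * f)))"
    by (simp add: jordan_self_adjoint)
  also have "2 *\<^sub>R (e * (e * f)) = e * f + (inner e f / inner e e) *\<^sub>R e"
    using primitive_compression[OF e, of f] by (simp add: algebra_simps)
  also have "inner f \<dots> = inner e f * (1 + inner e f / inner e e)"
    using inner_idempotents[OF f, of e] by (simp add: inner_add_right inner_commute algebra_simps)
  finally show ?thesis .
qed

text \<open>The left side of \<open>primitive_product_norm\<close> is symmetric in \<open>e\<close> and \<open>f\<close>, hence so is the right.\<close>

lemma primitive_norms_equal: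
  fixes e f :: "'a::euclidean_jordan_algebra"
  assumes e: "primitive_idempotent e" and f: "primitive_idempotent f" and ne: "inner e f \<noteq> 0"
  shows "inner e e = inner f f"
proof -
  have id: "idempotent e" "idempotent f" "e \<noteq> 0" "f \<noteq> 0"
    using e f by (simp_all add: primitive_idempotent_def)
  have "inner e f * (1 + inner e f / inner e e) = inner e f * (1 + inner e f / inner f f)"
    using primitive_product_norm[OF e id(2)] primitive_product_norm[OF f id(1)]
    by (simp add: jordan_commute[of f e] inner_commute[of f e])
  then have "inner e f / inner e e = inner e f / inner f f" using ne by simp
  then show ?thesis using ne id by (simp add: field_simps)
qed

section \<open>Jordan frames and the spectral theorem\<close>

text \<open>Jordan frames as sets. Their members are nonzero and orthogonal, so a frame given as a list has
distinct entries, and sums over the set are more convenient than sums over indices.\<close>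

definition frame :: "'a::euclidean_jordan_algebra set \<Rightarrow> bool" where
  "frame F \<longleftrightarrow> orthogonal_idempotents F \<and> (\<forall>c\<in>F. primitive_idempotent c) \<and> \<Sum>F = 1"

lemma frameD:
  assumes "frame F"
  shows "orthogonal_idempotents F" "finite F" "\<Sum>F = 1"
    "c \<in> F \<Longrightarrow> primitive_idempotent c" "c \<in> F \<Longrightarrow> idempotent c" "c \<in> F \<Longrightarrow> c \<noteq> 0"
  using assms by (auto simp: frame_def orthogonal_idempotents_def)

lemma split_idempotent_orthogonal:
  fixes a b d :: "'a::euclidean_jordan_algebra"
  assumes "idempotent a" "idempotent b" "idempotent d" "(a + b) * d = 0"
  shows "a * d = 0" "b * d = 0"
proof -
  have "inner (a + b) d = 0" using inner_idempotents[OF assms(3), of "a + b"] assms(4) by simp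
  then have "inner a d = 0" "inner b d = 0"
    using inner_idempotents_nonneg[OF assms(1,3)] inner_idempotents_nonneg[OF assms(2,3)]
    by (auto simp: inner_add_left)
  then show "a * d = 0" "b * d = 0" using assms idempotents_orthogonal_iff by auto
qed

text \<open>Among the complete orthogonal systems in which \<open>x\<close> is diagonal, one with the most members is
primitive: if \<open>c = a + b\<close> could be split, then replacing \<open>c\<close> by \<open>a\<close> and \<open>b\<close> would again give such
a system, because \<open>a\<close> and \<open>b\<close> inherit from \<open>c\<close> the orthogonality to the other members.\<close>

theorem spectral_theorem:
  fixes x :: "'a::euclidean_jordan_algebra"
  shows "\<exists>F t. frame F \<and> x = (\<Sum>c\<in>F. t c *\<^sub>R c)"
proof -
  define P where "P C \<longleftrightarrow> orthogonal_idempotents C \<and> \<Sum>C = 1 \<and> (\<exists>t. x = (\<Sum>c\<in>C. t c *\<^sub>R c))" for C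
  have card_le: "card C \<le> DIM('a)" if "P C" for C
    using that orthogonal_idempotents_card_le by (auto simp: P_def)
  obtain C0 where "P C0" using spectral_idempotents_exist[of x] unfolding P_def by blast
  from maximal_card_exists[of P, OF this card_le]
  obtain C where PC: "P C" and max: "\<And>B. P B \<Longrightarrow> card B \<le> card C" by blast
  then obtain t where C: "orthogonal_idempotents C" "\<Sum>C = 1" and t: "x = (\<Sum>c\<in>C. t c *\<^sub>R c)"
    unfolding P_def by blast
  have fin: "finite C" using C(1) by (simp add: orthogonal_idempotents_def)
  have "primitive_idempotent c" if c: "c \<in> C" for c
  proof (rule ccontr)
    assume "\<not> primitive_idempotent c"
    then obtain a b where ab: "idempotent a" "idempotent b" "a \<noteq> 0" "b \<noteq> 0" "c = a + b"
      using C(1) c unfolding primitive_idempotent_def orthogonal_idempotents_def by blast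
    define D where "D = C - {c}"
    have finD: "finite D" using fin by (simp add: D_def)
    have idc: "idempotent (a + b)" using C(1) c ab(5) by (auto simp: orthogonal_idempotents_def)
    have ab0: "a * b = 0" by (rule idempotent_summands_orthogonal[OF ab(1,2) idc])
    have D: "a * d = 0" "b * d = 0" "d * a = 0" "d * b = 0" if "d \<in> D" for d
    proof -
      have "idempotent d" "(a + b) * d = 0"
        using C(1) c that unfolding D_def orthogonal_idempotents_def ab(5) by auto
      then show "a * d = 0" "b * d = 0" using split_idempotent_orthogonal[OF ab(1,2)] by auto
      then show "d * a = 0" "d * b = 0" by (simp_all add: jordan_commute)
    qed
    have notin: "a \<notin> D" "b \<notin> D" "a \<noteq> b"
      using D[of a] D[of b] ab ab0 by (auto simp: idempotent_def)
    define B where "B = insert a (insert b D)"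
    define s where "s = (\<lambda>d. if d \<in> D then t d else t c)"
    have sum_C: "(\<Sum>d\<in>C. g d) = g c + (\<Sum>d\<in>D. g d)" for g :: "'a \<Rightarrow> 'a"
      unfolding D_def by (rule sum.remove[OF fin c])
    have "orthogonal_idempotents B"
    proof -
      have "b * a = 0" using ab0 by (simp add: jordan_commute)
      moreover have "idempotent d \<and> d \<noteq> 0" "d' \<in> D \<Longrightarrow> d \<noteq> d' \<Longrightarrow> d * d' = 0" if "d \<in> D" for d d'
        using C(1) that by (auto simp: orthogonal_idempotents_def D_def)
      ultimately show ?thesis
        unfolding orthogonal_idempotents_def B_def using ab(1-4) ab0 D finD by auto
    qed
    moreover have "\<Sum>B = 1"
      using finD notin C(2) sum_C[of "\<lambda>d. d"] ab(5) by (simp add: B_def add.assoc)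
    moreover have "x = (\<Sum>d\<in>B. s d *\<^sub>R d)"
    proof -
      have "(\<Sum>d\<in>B. s d *\<^sub>R d) = t c *\<^sub>R a + (t c *\<^sub>R b + (\<Sum>d\<in>D. s d *\<^sub>R d))"
        using finD notin by (simp add: B_def s_def)
      also have "(\<Sum>d\<in>D. s d *\<^sub>R d) = (\<Sum>d\<in>D. t d *\<^sub>R d)" by (simp add: s_def)
      finally show ?thesis using sum_C[of "\<lambda>d. t d *\<^sub>R d"] ab(5) t
        by (simp add: scaleR_add_right add.assoc)
    qed
    ultimately have "P B" unfolding P_def by blast
    moreover have "card B = Suc (card C)"
      using finD notin card.remove[OF fin c] by (simp add: B_def D_def)
    ultimately show False using max by fastforce
  qed
  then have "frame C" using C by (simp add: frame_def)
  then show ?thesis using t by blast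
qed

text \<open>The transition matrix between two frames is doubly stochastic. The row sums are immediate from
\<open>\<Sum>G = 1\<close>; for the column sums the normalising factor is first changed from \<open>inner c c\<close> to
\<open>inner d d\<close>, which \<open>primitive_norms_equal\<close> permits wherever the entry is nonzero.\<close>

lemma frame_transition_sums:
  assumes F: "frame F" and G: "frame G"
  shows "c \<in> F \<Longrightarrow> (\<Sum>d\<in>G. inner c d / inner c c) = 1"
    and "d \<in> G \<Longrightarrow> (\<Sum>c\<in>F. inner c d / inner c c) = 1"
proof -
  assume c: "c \<in> F"
  have "(\<Sum>d\<in>G. inner c d / inner c c) = inner c (\<Sum>G) / inner c c"
    by (simp add: inner_sum_right sum_divide_distrib)
  then show "(\<Sum>d\<in>G. inner c d / inner c c) = 1"
    using inner_idempotent_one[OF frameD(5)[OF F c]] frameD(6)[OF F c] frameD(3)[OF G] by simp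
next
  assume d: "d \<in> G"
  have "(\<Sum>c\<in>F. inner c d / inner c c) = (\<Sum>c\<in>F. inner c d / inner d d)"
    using primitive_norms_equal[OF frameD(4)[OF F] frameD(4)[OF G d]]
    \<comment> \<open>where \<open>inner c d = 0\<close> both quotients vanish\<close>
    by (intro sum.cong refl) (metis div_0)
  also have "\<dots> = inner (\<Sum>F) d / inner d d" by (simp add: inner_sum_left sum_divide_distrib)
  finally show "(\<Sum>c\<in>F. inner c d / inner c c) = 1"
    using inner_idempotent_one[OF frameD(5)[OF G d]] frameD(6)[OF G d] frameD(3)[OF F]
      inner_commute[of 1 d] by simp
qed

text \<open>Eigenvectors of a self-adjoint operator, here multiplication by the common sum, for different
eigenvalues are orthogonal.\<close>

lemma spectral_values_agree:
  assumes F: "frame F" and G: "frame G"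
    and eq: "(\<Sum>c\<in>F. t c *\<^sub>R c) = (\<Sum>d\<in>G. s d *\<^sub>R d)"
    and c: "c \<in> F" and d: "d \<in> G" and ne: "inner c d \<noteq> 0"
  shows "t c = s d"
proof -
  define x where "x = (\<Sum>c\<in>F. t c *\<^sub>R c)"
  have "x * c = t c *\<^sub>R c" "x * d = s d *\<^sub>R d"
    using orthogonal_idempotents_mult[OF frameD(1)[OF F] c, of t]
      orthogonal_idempotents_mult[OF frameD(1)[OF G] d, of s] by (simp_all add: x_def eq)
  then show ?thesis using jordan_self_adjoint[of x c d] ne by simp
qed

text \<open>The multiplicity of \<open>r\<close> in either frame is the sum of the entries of the transition matrix over
all pairs \<open>c\<close>, \<open>d\<close> at which both values equal \<open>r\<close>: a nonzero entry forces the values to agree.\<close>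

lemma spectral_values_unique:
  assumes F: "frame F" and G: "frame G"
    and eq: "(\<Sum>c\<in>F. t c *\<^sub>R c) = (\<Sum>d\<in>G. s d *\<^sub>R d)"
  shows "image_mset t (mset_set F) = image_mset s (mset_set G)"
proof (rule multiset_eqI)
  fix r :: real
  define w where "w c d = inner c d / inner c c" for c d :: 'a
  note fin = frameD(2)[OF F] frameD(2)[OF G]
  have agree: "w c d = 0 \<or> t c = s d" if "c \<in> F" "d \<in> G" for c d
    using spectral_values_agree[OF F G eq that] by (auto simp: w_def)
  have "real (card {c\<in>F. t c = r}) = (\<Sum>c\<in>F. if t c = r then 1 else 0)"
    using fin by (simp add: sum.If_cases Collect_conj_eq Int_commute)
  also have "\<dots> = (\<Sum>c\<in>F. \<Sum>d\<in>G. if t c = r then w c d else 0)"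
    using frame_transition_sums(1)[OF F G] by (intro sum.cong refl) (simp add: w_def)
  also have "\<dots> = (\<Sum>c\<in>F. \<Sum>d\<in>G. if s d = r then w c d else 0)"
    using agree by (intro sum.cong refl) force
  also have "\<dots> = (\<Sum>d\<in>G. \<Sum>c\<in>F. if s d = r then w c d else 0)" by (rule sum.swap)
  also have "\<dots> = (\<Sum>d\<in>G. if s d = r then 1 else 0)"
    using frame_transition_sums(2)[OF F G] by (intro sum.cong refl) (simp add: w_def)
  also have "\<dots> = real (card {d\<in>G. s d = r})"
    using fin by (simp add: sum.If_cases Collect_conj_eq Int_commute)
  finally show "count (image_mset t (mset_set F)) r = count (image_mset s (mset_set G)) r"
    using fin by (simp add: count_image_mset_eq_card_vimage)
qed

lemma frames_equal_card:
  fixes F G :: "'a::euclidean_jordan_algebra set"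
  assumes F: "frame F" and G: "frame G"
  shows "card F = card G"
proof -
  have "(\<Sum>c\<in>F. (\<lambda>_. 1) c *\<^sub>R c) = (\<Sum>d\<in>G. (\<lambda>_. 1) d *\<^sub>R d)"
    using frameD(3)[OF F] frameD(3)[OF G] by simp
  from spectral_values_unique[OF F G this] show ?thesis
    by (metis size_image_mset size_mset_set)
qed

text \<open>Since \<open>inner c d\<close> vanishes unless \<open>t c = s d\<close>, the inner product of the two sides equals the
square of the norm of each of them, so their difference has norm zero.\<close>

lemma spectral_calculus_unique:
  fixes g :: "real \<Rightarrow> real"
  assumes F: "frame F" and G: "frame G"
    and eq: "(\<Sum>c\<in>F. t c *\<^sub>R c) = (\<Sum>d\<in>G. s d *\<^sub>R d)"
  shows "(\<Sum>c\<in>F. g (t c) *\<^sub>R c) = (\<Sum>d\<in>G. g (s d) *\<^sub>R d)"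
proof -
  define u v where "u = (\<Sum>c\<in>F. g (t c) *\<^sub>R c)" and "v = (\<Sum>d\<in>G. g (s d) *\<^sub>R d)"
  have mixed: "g (t c) * inner c d = g (s d) * inner c d" if "c \<in> F" "d \<in> G" for c d
    using spectral_values_agree[OF F G eq that] by (cases "inner c d = 0") auto
  have "inner u v = (\<Sum>c\<in>F. \<Sum>d\<in>G. g (t c) * (g (s d) * inner c d))"
    unfolding u_def inner_sum_left unfolding v_def inner_sum_right
    by (simp add: sum_distrib_left mult.left_commute)
  also have "\<dots> = (\<Sum>c\<in>F. \<Sum>d\<in>G. g (t c) * (g (t c) * inner c d))"
    by (intro sum.cong refl) (simp only: mixed)
  also have "\<dots> = (\<Sum>c\<in>F. g (t c) * g (t c) * inner c (\<Sum>G))"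
    by (simp add: inner_sum_right sum_distrib_left mult.assoc)
  also have "\<dots> = inner (\<Sum>c\<in>F. (g (t c) * g (t c)) *\<^sub>R c) 1"
    by (simp add: inner_sum_left frameD(3)[OF G])
  also have "\<dots> = inner u u"
    using inner_jordan_assoc[of u u 1]
    by (simp add: u_def orthogonal_idempotents_calculus_mult[OF frameD(1)[OF F]] jordan_unit_right)
  finally have uu: "inner u v = inner u u" .
  have "inner u v = (\<Sum>c\<in>F. \<Sum>d\<in>G. g (s d) * (g (t c) * inner c d))"
    unfolding u_def inner_sum_left unfolding v_def inner_sum_right
    by (simp add: sum_distrib_left mult.left_commute)
  also have "\<dots> = (\<Sum>c\<in>F. \<Sum>d\<in>G. g (s d) * (g (s d) * inner c d))"
    by (intro sum.cong refl) (simp only: mixed)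
  also have "\<dots> = (\<Sum>d\<in>G. \<Sum>c\<in>F. g (s d) * (g (s d) * inner c d))" by (rule sum.swap)
  also have "\<dots> = (\<Sum>d\<in>G. g (s d) * g (s d) * inner (\<Sum>F) d)"
    by (simp add: inner_sum_left sum_distrib_left mult.assoc)
  also have "\<dots> = inner (\<Sum>d\<in>G. (g (s d) * g (s d)) *\<^sub>R d) 1"
    by (simp add: inner_sum_left frameD(3)[OF F] inner_commute[of 1])
  also have "\<dots> = inner v v"
    using inner_jordan_assoc[of v v 1]
    by (simp add: v_def orthogonal_idempotents_calculus_mult[OF frameD(1)[OF G]] jordan_unit_right)
  finally have "inner (u - v) (u - v) = 0"
    using uu by (simp add: inner_diff_left inner_diff_right inner_commute[of v u])
  then show ?thesis by (simp add: u_def v_def)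
qed

section \<open>Eigenvalue lists\<close>

lemma distinct_orthogonal_list_iff:
  assumes "\<And>c. c \<in> set es \<Longrightarrow> c * c \<noteq> (0 :: 'a::euclidean_jordan_algebra)"
  shows "(\<forall>i<length es. \<forall>j<length es. i \<noteq> j \<longrightarrow> es ! i * es ! j = 0) \<longleftrightarrow>
    distinct es \<and> (\<forall>c\<in>set es. \<forall>d\<in>set es. c \<noteq> d \<longrightarrow> c * d = 0)" (is "?L \<longleftrightarrow> ?R")
proof
  assume ?L
  then have "distinct es" unfolding distinct_conv_nth using assms by (metis nth_mem)
  moreover have "c * d = 0" if "c \<in> set es" "d \<in> set es" "c \<noteq> d" for c d
    using \<open>?L\<close> that by (metis in_set_conv_nth)
  ultimately show ?R by blast
next
  assume ?R
  then show ?L by (simp add: nth_eq_iff_index_eq)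
qed

lemma jordan_frame_iff: "jordan_frame es \<longleftrightarrow> distinct es \<and> frame (set es)"
proof (cases "\<forall>c\<in>set es. primitive_idempotent c")
  case True
  then have "idempotent c \<and> c \<noteq> 0" if "c \<in> set es" for c
    using that by (simp add: primitive_idempotent_def)
  moreover have "sum_list es = \<Sum>(set es)" if "distinct es"
    using that by (simp add: sum_list_distinct_conv_sum_set[of es "\<lambda>x. x", simplified])
  ultimately show ?thesis
    using True distinct_orthogonal_list_iff[of es]
    unfolding jordan_frame_def frame_def orthogonal_idempotents_def by (auto simp: idempotent_def)
qed (auto simp: jordan_frame_def frame_def)

lemma spectral_decomposition_iff:
  "spectral_decomposition x xs es \<longleftrightarrow>
    distinct es \<and> frame (set es) \<and> (\<exists>t. xs = map t es \<and> x = (\<Sum>c\<in>set es. t c *\<^sub>R c))"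
proof -
  have sum: "(\<Sum>i<length es. (map t es ! i) *\<^sub>R (es ! i)) = (\<Sum>c\<in>set es. t c *\<^sub>R c)" if "distinct es" for t
    using sum.reindex_bij_betw[OF bij_betw_nth[OF that refl refl], of "\<lambda>c. t c *\<^sub>R c"] by simp
  have map: "\<exists>t. xs = map t es" if "distinct es" "length xs = length es"
    using that by (intro exI[of _ "\<lambda>c. the (map_of (zip es xs) c)"] nth_equalityI)
      (simp_all add: map_of_zip_nth)
  show ?thesis
  proof
    assume L: "spectral_decomposition x xs es"
    then have es: "distinct es" "frame (set es)" "length xs = length es"
      by (simp_all add: spectral_decomposition_def jordan_frame_iff)
    then obtain t where t: "xs = map t es" using map by blast
    have "x = (\<Sum>c\<in>set es. t c *\<^sub>R c)"
      using L unfolding spectral_decomposition_def t sum[OF es(1)] by blast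
    then show "distinct es \<and> frame (set es) \<and> (\<exists>t. xs = map t es \<and> x = (\<Sum>c\<in>set es. t c *\<^sub>R c))"
      using es t by blast
  next
    assume "distinct es \<and> frame (set es) \<and> (\<exists>t. xs = map t es \<and> x = (\<Sum>c\<in>set es. t c *\<^sub>R c))"
    then obtain t where "distinct es" "frame (set es)" "xs = map t es" "x = (\<Sum>c\<in>set es. t c *\<^sub>R c)"
      by blast
    then show "spectral_decomposition x xs es"
      by (simp only: spectral_decomposition_def jordan_frame_iff sum length_map simp_thms)
  qed
qed

text \<open>The description by \<open>THE\<close> that defines \<open>jabs\<close> is justified by \<open>spectral_calculus_unique\<close> for
the absolute value.\<close>

lemma jabs_frame:
  assumes F: "frame F"
  shows "jabs (\<Sum>c\<in>F. t c *\<^sub>R c) = (\<Sum>c\<in>F. \<bar>t c\<bar> *\<^sub>R c)"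
  unfolding jabs_def
proof (rule the_equality)
  have sum: "(\<Sum>i<length es. \<bar>map s es ! i\<bar> *\<^sub>R (es ! i)) = (\<Sum>c\<in>set es. \<bar>s c\<bar> *\<^sub>R c)"
    if "distinct es" for s and es :: "'a list"
    using sum.reindex_bij_betw[OF bij_betw_nth[OF that refl refl], of "\<lambda>c. \<bar>s c\<bar> *\<^sub>R c"] by simp
  obtain es where es: "set es = F" "distinct es"
    using finite_distinct_list[OF frameD(2)[OF F]] by blast
  have "spectral_decomposition (\<Sum>c\<in>F. t c *\<^sub>R c) (map t es) es"
    unfolding spectral_decomposition_iff using es F by blast
  then show "\<exists>xs es. spectral_decomposition (\<Sum>c\<in>F. t c *\<^sub>R c) xs es \<and>
      (\<Sum>c\<in>F. \<bar>t c\<bar> *\<^sub>R c) = (\<Sum>i<length es. \<bar>xs ! i\<bar> *\<^sub>R (es ! i))"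
    using sum[OF es(2), of t] es(1) by (intro exI[of _ "map t es"] exI[of _ es]) simp
  fix y
  assume "\<exists>xs es. spectral_decomposition (\<Sum>c\<in>F. t c *\<^sub>R c) xs es \<and>
      y = (\<Sum>i<length es. \<bar>xs ! i\<bar> *\<^sub>R (es ! i))"
  then obtain es s where es: "distinct es" "frame (set es)"
    "(\<Sum>c\<in>F. t c *\<^sub>R c) = (\<Sum>c\<in>set es. s c *\<^sub>R c)"
    "y = (\<Sum>i<length es. \<bar>map s es ! i\<bar> *\<^sub>R (es ! i))"
    unfolding spectral_decomposition_iff by blast
  then show "y = (\<Sum>c\<in>F. \<bar>t c\<bar> *\<^sub>R c)"
    using sum[OF es(1), of s] spectral_calculus_unique[OF F es(2,3), of abs] by simp
qed

lemma decreasing_mset_unique: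
  fixes xs ys :: "real list"
  assumes "sorted_wrt (\<ge>) xs" "sorted_wrt (\<ge>) ys" "mset xs = mset ys"
  shows "xs = ys"
proof -
  have "sorted (rev xs)" "sorted (rev ys)" using assms(1,2) by (simp_all add: sorted_wrt_rev)
  moreover have "mset (rev xs) = mset (rev ys)" using assms(3) by simp
  ultimately have "rev xs = rev ys" by (metis properties_for_sort)
  then show ?thesis by simp
qed

lemma eigenvalues_frame:
  assumes es: "distinct es" "frame (set es)" and sorted: "sorted_wrt (\<ge>) (map t es)"
  shows "eigenvalues (\<Sum>c\<in>set es. t c *\<^sub>R c) = map t es"
  unfolding eigenvalues_def
proof (rule the_equality)
  show "sorted_wrt (\<ge>) (map t es) \<and>
      (\<exists>fs. spectral_decomposition (\<Sum>c\<in>set es. t c *\<^sub>R c) (map t es) fs)"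
    using es sorted unfolding spectral_decomposition_iff by blast
  fix xs
  assume xs: "sorted_wrt (\<ge>) xs \<and> (\<exists>fs. spectral_decomposition (\<Sum>c\<in>set es. t c *\<^sub>R c) xs fs)"
  then obtain fs s where fs: "distinct fs" "frame (set fs)" "xs = map s fs"
    "(\<Sum>c\<in>set es. t c *\<^sub>R c) = (\<Sum>c\<in>set fs. s c *\<^sub>R c)"
    unfolding spectral_decomposition_iff by blast
  have "mset (map t es) = mset (map s fs)"
    using spectral_values_unique[OF es(2) fs(2,4)] es(1) fs(1) by (simp add: mset_set_set)
  then show "xs = map t es" using decreasing_mset_unique xs sorted fs(3) by metis
qed

lemma decreasing_enumeration:
  fixes f :: "'b \<Rightarrow> real"
  assumes "finite A"
  shows "\<exists>es. distinct es \<and> set es = A \<and> sorted_wrt (\<ge>) (map f es)"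
proof -
  obtain l where l: "set l = A" "distinct l" using finite_distinct_list[OF assms] by blast
  have "sorted_wrt (\<ge>) (map f (rev (sort_key f l)))"
    by (simp add: rev_map[symmetric] sorted_wrt_rev)
  then show ?thesis using l by (intro exI[of _ "rev (sort_key f l)"]) simp
qed

text \<open>The frame is enumerated by decreasing absolute value of the coefficients, so that the same list
orders the decomposition of \<open>x\<close> and the eigenvalues of \<open>|x|\<close>.\<close>

lemma ordered_spectral_theorem:
  fixes x :: "'a::euclidean_jordan_algebra"
  shows "\<exists>es t. distinct es \<and> frame (set es) \<and> x = (\<Sum>c\<in>set es. t c *\<^sub>R c) \<and>
    sorted_wrt (\<ge>) (map (\<lambda>c. \<bar>t c\<bar>) es) \<and> eigenvalues (jabs x) = map (\<lambda>c. \<bar>t c\<bar>) es"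
proof -
  obtain F t where F: "frame F" and x: "x = (\<Sum>c\<in>F. t c *\<^sub>R c)"
    using spectral_theorem by blast
  obtain es where es: "distinct es" "set es = F" "sorted_wrt (\<ge>) (map (\<lambda>c. \<bar>t c\<bar>) es)"
    using decreasing_enumeration[OF frameD(2)[OF F]] by blast
  have "eigenvalues (jabs x) = map (\<lambda>c. \<bar>t c\<bar>) es"
    using eigenvalues_frame[OF es(1) _ es(3)] F es(2) unfolding x jabs_frame[OF F] by simp
  then show ?thesis using es F x by blast
qed

lemma jtrace_frame:
  assumes F: "frame F"
  shows "jtrace (\<Sum>c\<in>F. t c *\<^sub>R c) = (\<Sum>c\<in>F. t c)"
proof -
  obtain es where es: "distinct es" "set es = F" "sorted_wrt (\<ge>) (map t es)"
    using decreasing_enumeration[OF frameD(2)[OF F]] by blast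
  have "jtrace (\<Sum>c\<in>set es. t c *\<^sub>R c) = sum_list (map t es)"
    using eigenvalues_frame[OF es(1) _ es(3)] F es(2) by (simp add: jtrace_def)
  then show ?thesis using es(1,2) by (simp add: sum_list_distinct_conv_sum_set)
qed

section \<open>The rank is the length of every Jordan frame\<close>

lemma frame_power:
  assumes F: "frame F"
  shows "(\<Sum>c\<in>F. t c *\<^sub>R c) ^ k = (\<Sum>c\<in>F. t c ^ k *\<^sub>R c)"
  by (induction k)
    (simp_all add: frameD(3)[OF F] orthogonal_idempotents_calculus_mult[OF frameD(1)[OF F]])

text \<open>Otherwise the powers of \<open>x\<close> with exponents \<open>0, \<dots>, card F\<close> would be independent, yet all of them
lie in the span of a frame that diagonalises \<open>x\<close>, and that frame has only \<open>card F\<close> members.\<close>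

lemma annihilating_power_exists:
  fixes x :: "'a::euclidean_jordan_algebra" and F :: "'a set"
  assumes F: "frame F"
  shows "\<exists>d\<le>card F. x ^ d \<in> span ((\<lambda>i. x ^ i) ` {..<d})"
proof (rule ccontr)
  obtain G t where G: "frame G" and x: "x = (\<Sum>c\<in>G. t c *\<^sub>R c)"
    using spectral_theorem by blast
  assume "\<not> ?thesis"
  then have new: "x ^ d \<notin> span ((\<lambda>i. x ^ i) ` {..<d})" if "d \<le> card G" for d
    using that frames_equal_card[OF F G] by auto
  have "independent ((\<lambda>i. x ^ i) ` {..<d}) \<and> card ((\<lambda>i. x ^ i) ` {..<d}) = d"
    if "d \<le> Suc (card G)" for d
    using that
  proof (induction d)
    case (Suc d)
    define S where "S = (\<lambda>i. x ^ i) ` {..<d}"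
    have "x ^ d \<notin> span S" unfolding S_def using new Suc.prems by simp
    moreover from this have "x ^ d \<notin> S" using span_base by metis
    moreover have "independent S" "card S = d" "finite S" using Suc by (simp_all add: S_def)
    moreover have "(\<lambda>i. x ^ i) ` {..<Suc d} = insert (x ^ d) S" by (simp add: S_def lessThan_Suc)
    ultimately show ?case by (simp add: independent_insertI)
  qed (simp add: independent_empty)
  note indep = this[OF order_refl]
  have "x ^ i \<in> span G" for i
    unfolding x frame_power[OF G] by (intro span_sum span_scale span_base)
  then have "(\<lambda>i. x ^ i) ` {..<Suc (card G)} \<subseteq> span G" by blast
  from independent_span_bound[OF frameD(2)[OF G] conjunct1[OF indep] this]
  show False using indep by simp
qed

lemma jdegree_le_card:
  fixes x :: "'a::euclidean_jordan_algebra" and F :: "'a set"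
  assumes F: "frame F"
  shows "jdegree x \<le> card F"
proof -
  obtain d where "d \<le> card F" "x ^ d \<in> span ((\<lambda>i. x ^ i) ` {..<d})"
    using annihilating_power_exists[OF F] by blast
  then show ?thesis unfolding jdegree_def by (meson Least_le le_trans)
qed

text \<open>A monic polynomial annihilating the sum vanishes at every value of \<open>t\<close>, so its degree is at
least the number of these values.\<close>

lemma jdegree_ge_card:
  fixes F :: "'a::euclidean_jordan_algebra set"
  assumes F: "frame F" and inj: "inj_on t F"
  shows "card F \<le> jdegree (\<Sum>c\<in>F. t c *\<^sub>R c)"
proof -
  define x where "x = (\<Sum>c\<in>F. t c *\<^sub>R c)"
  define d where "d = jdegree x"
  have "x ^ d \<in> span ((\<lambda>i. x ^ i) ` {..<d})"
    unfolding d_def jdegree_def using annihilating_power_exists[OF F, of x] by (auto intro: LeastI_ex)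
  have "\<exists>a. y = (\<Sum>c\<in>F. (\<Sum>i<d. a i * t c ^ i) *\<^sub>R c)" if "y \<in> span ((\<lambda>i. x ^ i) ` {..<d})" for y
    using that
  proof (induction rule: span_induct_alt)
    case base
    show ?case by (rule exI[of _ "\<lambda>_. 0"]) simp
  next
    case (step r v y)
    from step(1) obtain k where k: "k < d" "v = x ^ k" by blast
    from step obtain a where a: "y = (\<Sum>c\<in>F. (\<Sum>i<d. a i * t c ^ i) *\<^sub>R c)" by blast
    have "(\<Sum>i<d. (a i + (if i = k then r else 0)) * t c ^ i) = r * t c ^ k + (\<Sum>i<d. a i * t c ^ i)" for c
    proof -
      have "(\<Sum>i<d. (a i + (if i = k then r else 0)) * t c ^ i)
          = (\<Sum>i<d. a i * t c ^ i) + (\<Sum>i<d. if i = k then r * t c ^ k else 0)"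
        unfolding sum.distrib[symmetric] by (intro sum.cong) (auto simp: algebra_simps)
      then show ?thesis using k(1) by simp
    qed
    then have "r *\<^sub>R v + y = (\<Sum>c\<in>F. (\<Sum>i<d. (a i + (if i = k then r else 0)) * t c ^ i) *\<^sub>R c)"
      unfolding k(2) a x_def frame_power[OF F]
      by (simp add: scaleR_add_left sum.distrib scaleR_sum_right)
    then show ?case by (intro exI[of _ "\<lambda>i. a i + (if i = k then r else 0)"])
  qed
  then obtain a where "x ^ d = (\<Sum>c\<in>F. (\<Sum>i<d. a i * t c ^ i) *\<^sub>R c)"
    using \<open>x ^ d \<in> _\<close> by blast
  then have eq: "(\<Sum>c\<in>F. t c ^ d *\<^sub>R c) = (\<Sum>c\<in>F. (\<Sum>i<d. a i * t c ^ i) *\<^sub>R c)"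
    by (simp add: x_def frame_power[OF F])
  have root: "t c ^ d = (\<Sum>i<d. a i * t c ^ i)" if "c \<in> F" for c
    using orthogonal_idempotents_mult[OF frameD(1)[OF F] that, of "\<lambda>c. t c ^ d"]
      orthogonal_idempotents_mult[OF frameD(1)[OF F] that, of "\<lambda>c. \<Sum>i<d. a i * t c ^ i"]
      frameD(6)[OF F that] unfolding eq by simp
  define b where "b i = (if i = d then - 1 else a i)" for i
  have "t ` F \<subseteq> {z. (\<Sum>i\<le>d. b i * z ^ i) = 0}"
    using root by (auto simp: b_def lessThan_Suc_atMost[symmetric])
  moreover have "finite {z. (\<Sum>i\<le>d. b i * z ^ i) = 0} \<and> card {z. (\<Sum>i\<le>d. b i * z ^ i) = 0} \<le> d"
    by (rule Transcendental.polyfun_rootbound[of b d d]) (simp_all add: b_def)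
  ultimately have "card (t ` F) \<le> d" using card_mono le_trans by blast
  then show ?thesis using card_image[OF inj] by (simp add: d_def x_def)
qed

theorem jrank_eq_card_frame:
  fixes F :: "'a::euclidean_jordan_algebra set"
  assumes F: "frame F"
  shows "jrank TYPE('a) = card F"
proof -
  have le: "\<And>x :: 'a. jdegree x \<le> card F" by (rule jdegree_le_card[OF F])
  have "finite (range (jdegree :: 'a \<Rightarrow> nat))"
    by (rule finite_subset[of _ "{..card F}"]) (use le in auto)
  moreover obtain h where "bij_betw h F {0..<card F}"
    using ex_bij_betw_finite_nat[OF frameD(2)[OF F]] by blast
  then have "inj_on (\<lambda>c. real (h c)) F" by (auto simp: bij_betw_def inj_on_def)
  from jdegree_ge_card[OF F this] le have "card F \<in> range (jdegree :: 'a \<Rightarrow> nat)"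
    by (metis le_antisym rangeI)
  ultimately show ?thesis unfolding jrank_def using le by (intro Max_eqI) auto
qed

section \<open>Ky Fan norms\<close>

text \<open>Comparing with the threshold \<open>a (es ! k)\<close>: weight placed behind the first \<open>k\<close> entries earns at
most the threshold, and the first \<open>k\<close> entries have room for it and earn at least as much.\<close>

lemma sum_weighted_le_top:
  fixes a w :: "'b \<Rightarrow> real"
  assumes dist: "distinct es" and sorted: "sorted_wrt (\<ge>) (map a es)"
    and a0: "\<And>c. c \<in> set es \<Longrightarrow> 0 \<le> a c"
    and w: "\<And>c. c \<in> set es \<Longrightarrow> 0 \<le> w c" "\<And>c. c \<in> set es \<Longrightarrow> w c \<le> 1"
    and sum_w: "(\<Sum>c\<in>set es. w c) \<le> real k"
  shows "(\<Sum>c\<in>set es. a c * w c) \<le> sum_list (map a (take k es))"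
proof (cases "k < length es")
  case True
  define A B th where "A = set (take k es)" and "B = set (drop k es)" and "th = a (es ! k)"
  have AB: "set es = A \<union> B" "A \<inter> B = {}" "finite A" "finite B"
    using dist set_take_disj_set_drop_if_distinct[OF dist order_refl]
    by (auto simp: A_def B_def set_append[symmetric] simp del: set_append)
  have cardA: "card A = k" using dist True by (simp add: A_def distinct_card)
  have ge: "a (es ! j) \<le> a (es ! i)" if "i \<le> j" "j < length es" for i j
    using sorted that by (cases "i = j") (auto simp: sorted_wrt_iff_nth_less)
  have A: "th \<le> a c" if "c \<in> A" for c
    using that ge True unfolding A_def th_def by (auto simp: in_set_conv_nth)
  have B: "a c \<le> th" if "c \<in> B" for c
    using that ge True unfolding B_def th_def by (auto simp: in_set_conv_nth)
  have th0: "0 \<le> th" using a0 True by (simp add: th_def)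
  have "(\<Sum>c\<in>set es. a c * w c) = (\<Sum>c\<in>A. a c * w c) + (\<Sum>c\<in>B. a c * w c)"
    unfolding AB(1) by (rule sum.union_disjoint) (use AB in auto)
  also have "\<dots> \<le> (\<Sum>c\<in>A. a c * w c) + (\<Sum>c\<in>B. th * w c)"
    using B w AB(1) by (intro add_left_mono sum_mono mult_right_mono) auto
  also have "\<dots> = (\<Sum>c\<in>A. a c * w c) + th * (\<Sum>c\<in>B. w c)" by (simp add: sum_distrib_left)
  also have "\<dots> \<le> (\<Sum>c\<in>A. a c * w c) + th * (real k - (\<Sum>c\<in>A. w c))"
    using sum_w th0 sum.union_disjoint[OF AB(3,4,2), of w] AB(1)
    by (intro add_left_mono mult_left_mono) auto
  also have "\<dots> = (\<Sum>c\<in>A. a c * w c + th * (1 - w c))"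
    by (simp add: sum.distrib sum_distrib_left[symmetric] sum_subtractf cardA)
  also have "\<dots> \<le> (\<Sum>c\<in>A. a c)"
  proof (rule sum_mono)
    fix c assume c: "c \<in> A"
    have "th * (1 - w c) \<le> a c * (1 - w c)"
      using A[OF c] w(2)[of c] c AB(1) by (intro mult_right_mono) auto
    then show "a c * w c + th * (1 - w c) \<le> a c" by (simp add: algebra_simps)
  qed
  also have "\<dots> = sum_list (map a (take k es))"
    using dist by (simp add: A_def sum_list_distinct_conv_sum_set)
  finally show ?thesis .
next
  case False
  have "(\<Sum>c\<in>set es. a c * w c) \<le> (\<Sum>c\<in>set es. a c)"
    using a0 w by (intro sum_mono) (simp add: mult_left_le)
  then show ?thesis using False dist by (simp add: sum_list_distinct_conv_sum_set)
qed

definition ky_fan :: "nat \<Rightarrow> 'a::euclidean_jordan_algebra \<Rightarrow> real" where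
  "ky_fan k y = sum_list (take k (eigenvalues (jabs y)))"

text \<open>These are the elements whose absolute value is an idempotent of rank \<open>k\<close>; they are the
extreme cases both for the dual description of \<open>ky_fan k\<close> and for the majorization.\<close>

definition signed_sums :: "nat \<Rightarrow> 'a::euclidean_jordan_algebra set" where
  "signed_sums k = {z. \<exists>F S s. frame F \<and> S \<subseteq> F \<and> card S = k \<and> (\<forall>c\<in>S. \<bar>s c\<bar> = 1) \<and>
     z = (\<Sum>c\<in>S. s c *\<^sub>R c)}"

text \<open>With the trace inner product every member of a frame is a unit vector, as its eigenvalues are
one \<open>1\<close> and otherwise \<open>0\<close>.\<close>

lemma frame_inner_self:
  fixes c :: "'a::euclidean_jordan_algebra"
  assumes trace_inner: "\<And>x y :: 'a. inner x y = jtrace (x * y)"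
    and F: "frame F" and c: "c \<in> F"
  shows "inner c c = 1"
proof -
  have "c = (\<Sum>d\<in>F. (if d = c then 1 else 0) *\<^sub>R d)"
    using c frameD(2)[OF F] by (simp add: if_distrib[of "\<lambda>r. r *\<^sub>R _"] cong: if_cong)
  then have "jtrace c = (\<Sum>d\<in>F. if d = c then 1 else 0)" using jtrace_frame[OF F] by metis
  then have "jtrace c = 1" using c frameD(2)[OF F] by simp
  moreover have "c * c = c" using frameD(5)[OF F c] by (simp add: idempotent_def)
  ultimately show ?thesis using trace_inner[of c c] by simp
qed

text \<open>The sum of the \<open>k\<close> frame members with the largest \<open>\<bar>t c\<bar>\<close>, each taken with the sign of \<open>t c\<close>,
is a maximiser. The sign of \<open>0\<close> is chosen as \<open>1\<close>, so that there are exactly \<open>k\<close> terms.\<close>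

lemma ky_fan_attained:
  fixes y :: "'a::euclidean_jordan_algebra"
  assumes trace_inner: "\<And>x y :: 'a. inner x y = jtrace (x * y)"
    and k: "k \<le> jrank TYPE('a)"
  shows "\<exists>z\<in>signed_sums k. inner y z = ky_fan k y"
proof -
  obtain es t where es: "distinct es" "frame (set es)" and y: "y = (\<Sum>c\<in>set es. t c *\<^sub>R c)"
    and ev: "eigenvalues (jabs y) = map (\<lambda>c. \<bar>t c\<bar>) es"
    using ordered_spectral_theorem[of y] by blast
  note orth = frameD(1)[OF es(2)]
  define S s where "S = set (take k es)" and "s = (\<lambda>c. if t c < 0 then - 1 else 1 :: real)"
  have S: "S \<subseteq> set es" by (simp add: S_def set_take_subset)
  have len: "length es = jrank TYPE('a)"
    using jrank_eq_card_frame[OF es(2)] distinct_card[OF es(1)] by simp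
  have "card S = k" using es(1) k len by (simp add: S_def distinct_card)
  then have "(\<Sum>c\<in>S. s c *\<^sub>R c) \<in> signed_sums k"
    unfolding signed_sums_def mem_Collect_eq using es S
    by (intro exI[of _ "set es"] exI[of _ S] exI[of _ s]) (auto simp: s_def)
  moreover have "inner y (\<Sum>c\<in>S. s c *\<^sub>R c) = ky_fan k y"
  proof -
    have "inner y c = t c" if "c \<in> S" for c
    proof -
      have "y * c = t c *\<^sub>R c" unfolding y using orthogonal_idempotents_mult[OF orth] S that by blast
      moreover have "inner y c = inner (y * c) c"
        using inner_idempotents frameD(5)[OF es(2)] S that by blast
      ultimately show ?thesis using frame_inner_self[OF trace_inner es(2)] S that by auto
    qed
    then have "inner y (\<Sum>c\<in>S. s c *\<^sub>R c) = (\<Sum>c\<in>S. \<bar>t c\<bar>)"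
      unfolding inner_sum_right by (intro sum.cong) (auto simp: s_def)
    also have "\<dots> = ky_fan k y"
      using es(1) by (simp add: ky_fan_def ev S_def take_map sum_list_distinct_conv_sum_set)
    finally show ?thesis .
  qed
  ultimately show ?thesis by blast
qed

text \<open>In a frame diagonalising \<open>y\<close>, the coefficient of \<open>z\<close> at \<open>c\<close> is bounded by a partial row sum \<open>w c\<close>
of the doubly stochastic transition matrix. Hence \<open>w c \<le> 1\<close>, and the \<open>w c\<close> add up to \<open>k\<close>, one
for each of the \<open>k\<close> columns used.\<close>

lemma ky_fan_upper:
  fixes y :: "'a::euclidean_jordan_algebra"
  assumes trace_inner: "\<And>x y :: 'a. inner x y = jtrace (x * y)"
    and z: "z \<in> signed_sums k"
  shows "inner y z \<le> ky_fan k y"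
proof -
  obtain es t where es: "distinct es" "frame (set es)" and y: "y = (\<Sum>c\<in>set es. t c *\<^sub>R c)"
    and sorted: "sorted_wrt (\<ge>) (map (\<lambda>c. \<bar>t c\<bar>) es)"
    and ev: "eigenvalues (jabs y) = map (\<lambda>c. \<bar>t c\<bar>) es"
    using ordered_spectral_theorem[of y] by blast
  obtain G S s where G: "frame G" "S \<subseteq> G" "card S = k" "\<And>d. d \<in> S \<Longrightarrow> \<bar>s d\<bar> = 1"
    and z: "z = (\<Sum>d\<in>S. s d *\<^sub>R d)"
    using z unfolding signed_sums_def by blast
  define w where "w c = (\<Sum>d\<in>S. inner c d)" for c
  have nonneg: "0 \<le> inner c d" if "c \<in> set es" "d \<in> G" for c d
    using inner_idempotents_nonneg frameD(5)[OF es(2)] frameD(5)[OF G(1)] that by blast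
  have one: "inner c 1 = 1" if "frame F" "c \<in> F" for F and c :: 'a
    using frame_inner_self[OF trace_inner that] inner_idempotent_one[OF frameD(5)[OF that]] by simp
  have w0: "0 \<le> w c" if "c \<in> set es" for c
    unfolding w_def using nonneg that G(2) by (intro sum_nonneg) auto
  have w1: "w c \<le> 1" if "c \<in> set es" for c
  proof -
    have "w c \<le> (\<Sum>d\<in>G. inner c d)"
      unfolding w_def using nonneg that G(2) frameD(2)[OF G(1)] by (intro sum_mono2) auto
    also have "\<dots> = inner c (\<Sum>G)" by (simp add: inner_sum_right)
    finally show ?thesis using one[OF es(2) that] frameD(3)[OF G(1)] by simp
  qed
  have "(\<Sum>c\<in>set es. w c) = (\<Sum>d\<in>S. \<Sum>c\<in>set es. inner c d)" unfolding w_def by (rule sum.swap)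
  also have "\<dots> = (\<Sum>d\<in>S. inner d (\<Sum>(set es)))"
    by (simp add: inner_sum_right inner_commute)
  also have "\<dots> = (\<Sum>d\<in>S. 1)"
    using one[OF G(1)] G(2) frameD(3)[OF es(2)] by (intro sum.cong) auto
  finally have sum_w: "(\<Sum>c\<in>set es. w c) \<le> real k" using G(3) by simp
  have "inner y z = (\<Sum>c\<in>set es. t c * inner c z)" unfolding y by (simp add: inner_sum_left)
  also have "\<dots> \<le> (\<Sum>c\<in>set es. \<bar>t c\<bar> * w c)"
  proof (rule sum_mono)
    fix c assume c: "c \<in> set es"
    have "\<bar>inner c z\<bar> \<le> (\<Sum>d\<in>S. \<bar>s d * inner c d\<bar>)" unfolding z by (simp add: inner_sum_right sum_abs)
    also have "\<dots> = w c" unfolding w_def using G(2,4) nonneg[OF c] by (intro sum.cong) (auto simp: abs_mult)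
    finally have "\<bar>t c * inner c z\<bar> \<le> \<bar>t c\<bar> * w c" by (simp add: abs_mult mult_left_mono)
    then show "t c * inner c z \<le> \<bar>t c\<bar> * w c" by linarith
  qed
  also have "\<dots> \<le> ky_fan k y"
    using sum_weighted_le_top[OF es(1) sorted _ w0 w1 sum_w] by (simp add: ky_fan_def ev take_map)
  finally show ?thesis .
qed

text \<open>A maximum of linear functionals is sublinear.\<close>

lemma ky_fan_combination:
  fixes y :: "'i \<Rightarrow> 'a::euclidean_jordan_algebra"
  assumes trace_inner: "\<And>x y :: 'a. inner x y = jtrace (x * y)"
    and k: "k \<le> jrank TYPE('a)" and d: "\<And>i. i \<in> I \<Longrightarrow> 0 \<le> d i"
  shows "ky_fan k (\<Sum>i\<in>I. d i *\<^sub>R y i) \<le> (\<Sum>i\<in>I. d i * ky_fan k (y i))"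
proof -
  obtain z where z: "z \<in> signed_sums k" "inner (\<Sum>i\<in>I. d i *\<^sub>R y i) z = ky_fan k (\<Sum>i\<in>I. d i *\<^sub>R y i)"
    using ky_fan_attained[OF trace_inner k] by blast
  have "inner (\<Sum>i\<in>I. d i *\<^sub>R y i) z = (\<Sum>i\<in>I. d i * inner (y i) z)" by (simp add: inner_sum_left)
  also have "\<dots> \<le> (\<Sum>i\<in>I. d i * ky_fan k (y i))"
    using ky_fan_upper[OF trace_inner z(1)] d by (intro sum_mono mult_left_mono) auto
  finally show ?thesis using z(2) by simp
qed

lemma ky_fan_le_norm:
  fixes y :: "'a::euclidean_jordan_algebra"
  assumes trace_inner: "\<And>x y :: 'a. inner x y = jtrace (x * y)"
    and k: "k \<le> jrank TYPE('a)"
  shows "ky_fan k y \<le> real k * norm y"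
proof -
  obtain z where z: "z \<in> signed_sums k" "inner y z = ky_fan k y"
    using ky_fan_attained[OF trace_inner k] by blast
  then obtain F S s where F: "frame F" "S \<subseteq> F" "card S = k" "\<And>d. d \<in> S \<Longrightarrow> \<bar>s d\<bar> = 1"
    and z_eq: "z = (\<Sum>d\<in>S. s d *\<^sub>R d)" unfolding signed_sums_def by blast
  have "norm z \<le> (\<Sum>d\<in>S. norm (s d *\<^sub>R d))" unfolding z_eq by (rule norm_sum)
  also have "\<dots> = (\<Sum>d\<in>S. 1)"
    using F frame_inner_self[OF trace_inner F(1)] by (intro sum.cong) (auto simp: norm_eq_1)
  finally have "norm z \<le> real k" using F(3) by simp
  then have "norm y * norm z \<le> norm y * real k" by (rule mult_left_mono) simp
  then show ?thesis using norm_cauchy_schwarz[of y z] z(2) by (simp add: mult.commute)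
qed

lemma norm_le_max_eigenvalue:
  fixes x :: "'a::euclidean_jordan_algebra"
  assumes trace_inner: "\<And>x y :: 'a. inner x y = jtrace (x * y)"
  shows "norm x \<le> real (jrank TYPE('a)) * eigenvalues (jabs x) ! 0"
proof -
  obtain es t where es: "distinct es" "frame (set es)" and x: "x = (\<Sum>c\<in>set es. t c *\<^sub>R c)"
    and sorted: "sorted_wrt (\<ge>) (map (\<lambda>c. \<bar>t c\<bar>) es)"
    and ev: "eigenvalues (jabs x) = map (\<lambda>c. \<bar>t c\<bar>) es"
    using ordered_spectral_theorem[of x] by blast
  have le: "\<bar>t c\<bar> \<le> eigenvalues (jabs x) ! 0" if "c \<in> set es" for c
  proof -
    from that obtain j where j: "j < length es" "es ! j = c" unfolding in_set_conv_nth by blast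
    then have "map (\<lambda>c. \<bar>t c\<bar>) es ! 0 = \<bar>t (es ! 0)\<bar>" by (intro nth_map) linarith
    then show ?thesis
      using j sorted unfolding ev by (cases "j = 0") (auto simp: sorted_wrt_iff_nth_less)
  qed
  have "norm x \<le> (\<Sum>c\<in>set es. norm (t c *\<^sub>R c))" unfolding x by (rule norm_sum)
  also have "\<dots> \<le> (\<Sum>c\<in>set es. eigenvalues (jabs x) ! 0)"
  proof (rule sum_mono)
    fix c assume c: "c \<in> set es"
    have "norm c = 1" using frame_inner_self[OF trace_inner es(2) c] by (simp add: norm_eq_1)
    then show "norm (t c *\<^sub>R c) \<le> eigenvalues (jabs x) ! 0" using le[OF c] by simp
  qed
  finally show ?thesis using jrank_eq_card_frame[OF es(2)] by simp
qed

section \<open>Weak majorization of decreasing lists\<close>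

lemma decreasing_rearrangement_decreasing:
  assumes "sorted_wrt (\<ge>) p"
  shows "decreasing_rearrangement p = p"
proof -
  have "sorted (rev p)" using assms by (simp add: sorted_wrt_rev)
  then have "sort p = rev p" by (metis mset_rev properties_for_sort)
  then show ?thesis by (simp add: decreasing_rearrangement_def)
qed

lemma weakly_majorized_decreasing_iff:
  assumes p: "sorted_wrt (\<ge>) p" "length p = n" and q: "sorted_wrt (\<ge>) q" "length q = n"
  shows "p \<prec>\<^sub>w q \<longleftrightarrow> (\<forall>k\<le>n. sum_list (take k p) \<le> sum_list (take k q))"
proof -
  have "(\<forall>k\<in>{1..n}. sum_list (take k p) \<le> sum_list (take k q)) \<longleftrightarrow>
      (\<forall>k\<le>n. sum_list (take k p) \<le> sum_list (take k q))" (is "?L \<longleftrightarrow> ?R")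
  proof
    assume L: ?L
    show ?R
    proof (intro allI impI)
      fix k assume "k \<le> n"
      then show "sum_list (take k p) \<le> sum_list (take k q)" using L by (cases "k = 0") auto
    qed
  qed auto
  then show ?thesis
    using p(2) q(2)
    by (simp add: weakly_majorized_def decreasing_rearrangement_decreasing[OF p(1)]
        decreasing_rearrangement_decreasing[OF q(1)])
qed

lemma sum_list_take_nth:
  assumes "k \<le> length xs"
  shows "sum_list (take k xs) = (\<Sum>i<k. xs ! i)"
  using assms by (simp add: sum_list_sum_nth atLeast0LessThan)

lemma nonneg_decreasing_iff:
  "q \<in> nonneg_decreasing n \<longleftrightarrow> length q = n \<and> (\<forall>i<n. 0 \<le> q ! i) \<and> sorted_wrt (\<ge>) q"
  by (auto simp: nonneg_decreasing_def all_set_conv_all_nth)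

lemma componentwise_product_nonneg_decreasing:
  assumes p: "p \<in> nonneg_decreasing n" and q: "q \<in> nonneg_decreasing n"
  shows "p \<star> q \<in> nonneg_decreasing n"
  using assms
  by (auto simp: nonneg_decreasing_iff componentwise_product_def sorted_wrt_iff_nth_less
      intro!: mult_mono)

lemma sum_list_take_componentwise_product:
  assumes "length p = n" "length q = n" "k \<le> n"
  shows "sum_list (take k (p \<star> q)) = (\<Sum>i<k. p ! i * q ! i)"
  using assms by (simp add: componentwise_product_def sum_list_take_nth)

text \<open>Summation by parts, with \<open>a i\<close> written as the telescoping sum of the gaps
\<open>a l - a (Suc l)\<close> over \<open>i \<le> l < n\<close>. The truncation at \<open>k\<close> gives the index \<open>min k (Suc l)\<close>.\<close>

lemma abel_summation:
  fixes a :: "nat \<Rightarrow> real" and v :: "nat \<Rightarrow> 'b::real_vector"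
  assumes "k \<le> n" and a_n: "a n = 0"
  shows "(\<Sum>i<k. a i *\<^sub>R v i) = (\<Sum>l<n. (a l - a (Suc l)) *\<^sub>R (\<Sum>i<min k (Suc l). v i))"
  using assms(1)
proof (induction k)
  case (Suc k)
  have tail: "(\<Sum>l\<in>{k..<n}. a l - a (Suc l)) = a k"
    using sum_Suc_diff'[of k n "\<lambda>i. - a i"] Suc.prems a_n by simp
  have step: "(\<Sum>i<min (Suc k) (Suc l). v i) = (\<Sum>i<min k (Suc l). v i) + (if k \<le> l then v k else 0)" for l
  proof (cases "k \<le> l")
    case False
    then have "min (Suc k) (Suc l) = min k (Suc l)" by simp
    then show ?thesis using False by simp
  qed (simp add: min_def)
  have "(\<Sum>l<n. (a l - a (Suc l)) *\<^sub>R (\<Sum>i<min (Suc k) (Suc l). v i)) =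
      (\<Sum>i<k. a i *\<^sub>R v i) + (\<Sum>l<n. (a l - a (Suc l)) *\<^sub>R (if k \<le> l then v k else 0))"
    using Suc by (simp only: step scaleR_add_right sum.distrib)
  also have "(\<Sum>l<n. (a l - a (Suc l)) *\<^sub>R (if k \<le> l then v k else 0)) =
      (\<Sum>l\<in>{k..<n}. (a l - a (Suc l)) *\<^sub>R v k)"
    by (rule sum.mono_neutral_cong_right) auto
  also have "\<dots> = a k *\<^sub>R v k" by (simp only: scaleR_sum_left[symmetric] tail)
  finally show ?case by simp
qed simp

text \<open>The partial sums of a list in \<open>nonneg_decreasing n\<close> form an increasing concave sequence that
starts at \<open>0\<close>. All three properties pass to the pointwise infimum \<open>I\<close>, which is therefore again
the sequence of partial sums of such a list.\<close>

lemma least_concave_partial_sums: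
  assumes Q: "Q \<noteq> {}" "Q \<subseteq> nonneg_decreasing n"
  shows "\<exists>\<eta>\<in>nonneg_decreasing n.
    (\<forall>k\<le>n. \<forall>q\<in>Q. (\<Sum>i<k. \<eta> ! i) \<le> (\<Sum>i<k. q ! i)) \<and>
    (\<forall>k\<le>n. \<forall>b. (\<forall>q\<in>Q. b \<le> (\<Sum>i<k. q ! i)) \<longrightarrow> b \<le> (\<Sum>i<k. \<eta> ! i))"
proof -
  define I where "I k = (INF q\<in>Q. \<Sum>i<k. q ! i)" for k
  have q0: "0 \<le> q ! i" if "q \<in> Q" "i < n" for q i
    using that Q(2) by (auto simp: nonneg_decreasing_iff)
  have q_step: "q ! Suc i \<le> q ! i" if "q \<in> Q" "Suc i < n" for q i
    using that Q(2) by (auto simp: nonneg_decreasing_iff sorted_wrt_iff_nth_less)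
  have bdd: "bdd_below ((\<lambda>q. \<Sum>i<k. q ! i) ` Q)" if "k \<le> n" for k
    using that q0 by (intro bdd_belowI2[of _ 0] sum_nonneg) auto
  have lower: "I k \<le> (\<Sum>i<k. q ! i)" if "k \<le> n" "q \<in> Q" for k q
    unfolding I_def by (rule cINF_lower[OF bdd[OF that(1)] that(2)])
  have greatest: "b \<le> I k" if "\<And>q. q \<in> Q \<Longrightarrow> b \<le> (\<Sum>i<k. q ! i)" for b k
    unfolding I_def using Q(1) that by (rule cINF_greatest)
  define \<eta> where "\<eta> = map (\<lambda>i. I (Suc i) - I i) [0..<n]"
  have I0: "I 0 = 0" using Q(1) by (simp add: I_def)
  have sum: "(\<Sum>i<k. \<eta> ! i) = I k" if "k \<le> n" for k
  proof -
    have "(\<Sum>i<k. \<eta> ! i) = (\<Sum>i<k. I (Suc i) - I i)" using that by (simp add: \<eta>_def)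
    also have "\<dots> = I k" using I0 by (simp add: sum_lessThan_telescope)
    finally show ?thesis .
  qed
  have nonneg: "0 \<le> \<eta> ! i" if "i < n" for i
  proof -
    have "I i \<le> (\<Sum>i<Suc i. q ! i)" if "q \<in> Q" for q
      using lower[of i q] q0[of q i] that \<open>i < n\<close> by simp
    then have "I i \<le> I (Suc i)" by (rule greatest)
    then show ?thesis using that by (simp add: \<eta>_def)
  qed
  have step: "\<eta> ! Suc i \<le> \<eta> ! i" if i: "Suc i < n" for i
  proof -
    \<comment> \<open>concavity of the partial sums of \<open>q\<close>, with \<open>I\<close> in place of the outer terms\<close>
    have "(I (Suc (Suc i)) + I i) / 2 \<le> (\<Sum>i<Suc i. q ! i)" if "q \<in> Q" for q
      using lower[of "Suc (Suc i)" q] lower[of i q] q_step[of q i] that i by simp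
    then have "(I (Suc (Suc i)) + I i) / 2 \<le> I (Suc i)" by (rule greatest)
    then show ?thesis using that by (simp add: \<eta>_def)
  qed
  have "sorted_wrt (\<ge>) \<eta>"
    unfolding sorted_wrt_iff_nth_less
  proof (intro allI impI)
    fix i j assume "i < j" "j < length \<eta>"
    then have "j < n" by (simp add: \<eta>_def)
    with \<open>i < j\<close> show "\<eta> ! i \<ge> \<eta> ! j"
    proof (induction j)
      case (Suc j)
      then show ?case using step[of j] by (cases "i = j") (auto intro: order_trans)
    qed simp
  qed
  then have "\<eta> \<in> nonneg_decreasing n" using nonneg by (simp add: nonneg_decreasing_iff \<eta>_def)
  then show ?thesis using sum lower greatest by (intro bexI[of _ \<eta>]) auto
qed

section \<open>Majorants of a linear map\<close>

lemma eigenvalues_jabs_nonneg_decreasing: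
  fixes x :: "'a::euclidean_jordan_algebra"
  shows "eigenvalues (jabs x) \<in> nonneg_decreasing (jrank TYPE('a))"
proof -
  obtain es t where es: "distinct es" "frame (set es)" and "x = (\<Sum>c\<in>set es. t c *\<^sub>R c)"
    and "sorted_wrt (\<ge>) (map (\<lambda>c. \<bar>t c\<bar>) es)" "eigenvalues (jabs x) = map (\<lambda>c. \<bar>t c\<bar>) es"
    using ordered_spectral_theorem[of x] by blast
  then show ?thesis
    using jrank_eq_card_frame[OF es(2)] distinct_card[OF es(1)] by (simp add: nonneg_decreasing_iff)
qed

lemma weakly_majorized_ky_fan:
  fixes x y :: "'a::euclidean_jordan_algebra"
  assumes q: "q \<in> nonneg_decreasing (jrank TYPE('a))"
  shows "eigenvalues (jabs y) \<prec>\<^sub>w q \<star> eigenvalues (jabs x) \<longleftrightarrow>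
    (\<forall>k\<le>jrank TYPE('a). ky_fan k y \<le> (\<Sum>i<k. q ! i * eigenvalues (jabs x) ! i))"
proof -
  note x = eigenvalues_jabs_nonneg_decreasing[of x] and y = eigenvalues_jabs_nonneg_decreasing[of y]
  note qx = componentwise_product_nonneg_decreasing[OF q x]
  show ?thesis
    using x y q qx weakly_majorized_decreasing_iff[of "eigenvalues (jabs y)" "jrank TYPE('a)"
        "q \<star> eigenvalues (jabs x)"]
      sum_list_take_componentwise_product[of q "jrank TYPE('a)" "eigenvalues (jabs x)"]
    by (simp add: nonneg_decreasing_iff ky_fan_def)
qed

lemma eigenvalues_signed_sum:
  fixes z :: "'a::euclidean_jordan_algebra"
  assumes z: "z \<in> signed_sums m"
  shows "eigenvalues (jabs z) = replicate m 1 @ replicate (jrank TYPE('a) - m) 0"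
proof -
  obtain F S s where F: "frame F" "S \<subseteq> F" "card S = m" "\<And>c. c \<in> S \<Longrightarrow> \<bar>s c\<bar> = 1"
    and z_eq: "z = (\<Sum>c\<in>S. s c *\<^sub>R c)" using z unfolding signed_sums_def by blast
  define t where "t c = (if c \<in> S then s c else 0)" for c
  have finS: "finite S" "finite (F - S)" using frameD(2)[OF F(1)] F(2) finite_subset by auto
  obtain ls where ls: "set ls = S" "distinct ls" using finite_distinct_list[OF finS(1)] by blast
  obtain ms where ms: "set ms = F - S" "distinct ms" using finite_distinct_list[OF finS(2)] by blast
  define es where "es = ls @ ms"
  have es: "distinct es" "set es = F" using ls ms F(2) by (auto simp: es_def)
  have len: "length ls = m" "length ms = jrank TYPE('a) - m"
    using distinct_card[OF ls(2)] distinct_card[OF ms(2)] ls(1) ms(1) F(2,3) finS(1)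
      jrank_eq_card_frame[OF F(1)] by (simp_all add: card_Diff_subset)
  have "map (\<lambda>c. \<bar>t c\<bar>) ls = map (\<lambda>_. 1) ls" "map (\<lambda>c. \<bar>t c\<bar>) ms = map (\<lambda>_. 0) ms"
    using ls ms F(4) by (auto simp: t_def)
  then have map: "map (\<lambda>c. \<bar>t c\<bar>) es = replicate m 1 @ replicate (jrank TYPE('a) - m) 0"
    using len by (simp add: es_def map_replicate_const)
  then have sorted: "sorted_wrt (\<ge>) (map (\<lambda>c. \<bar>t c\<bar>) es)" by (simp add: sorted_wrt_iff_nth_less nth_append)
  have "z = (\<Sum>c\<in>set es. t c *\<^sub>R c)"
    unfolding z_eq es(2) t_def using F(2) frameD(2)[OF F(1)]
    by (intro sum.mono_neutral_cong_left) auto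
  then have "jabs z = (\<Sum>c\<in>set es. \<bar>t c\<bar> *\<^sub>R c)" using jabs_frame F(1) es(2) by metis
  then show ?thesis using eigenvalues_frame[OF es(1) _ sorted] F(1) es(2) map by simp
qed

text \<open>Each coefficient of \<open>x\<close> is a sign times the corresponding eigenvalue of \<open>|x|\<close>; summation by parts
then collects the signed frame members into the partial sums \<open>c l\<close>. The value \<open>0\<close> of \<open>a\<close> beyond
the last eigenvalue makes the last gap equal to the smallest eigenvalue.\<close>

lemma signed_sum_decomposition:
  fixes x :: "'a::euclidean_jordan_algebra"
  defines "n \<equiv> jrank TYPE('a)"
  defines "a \<equiv> (\<lambda>i. if i < n then eigenvalues (jabs x) ! i else 0)"
  shows "\<exists>c. (\<forall>l<n. c l \<in> signed_sums (Suc l)) \<and> x = (\<Sum>l<n. (a l - a (Suc l)) *\<^sub>R c l)"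
proof -
  obtain es t where es: "distinct es" "frame (set es)" and x: "x = (\<Sum>c\<in>set es. t c *\<^sub>R c)"
    and ev: "eigenvalues (jabs x) = map (\<lambda>c. \<bar>t c\<bar>) es"
    using ordered_spectral_theorem[of x] by blast
  have len: "length es = n"
    using jrank_eq_card_frame[OF es(2)] distinct_card[OF es(1)] by (simp add: n_def)
  define s where "s = (\<lambda>c. if t c < 0 then - 1 else 1 :: real)"
  define c where "c l = (\<Sum>i<Suc l. s (es ! i) *\<^sub>R (es ! i))" for l
  have "c l \<in> signed_sums (Suc l)" if "l < n" for l
  proof -
    have inj: "inj_on ((!) es) {..<Suc l}" using es(1) that len by (auto simp: inj_on_def nth_eq_iff_index_eq)
    have sub: "(!) es ` {..<Suc l} \<subseteq> set es" using that len by auto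
    have "c l = (\<Sum>e\<in>(!) es ` {..<Suc l}. s e *\<^sub>R e)"
      unfolding c_def using sum.reindex[OF inj, of "\<lambda>e. s e *\<^sub>R e"] by simp
    moreover have "card ((!) es ` {..<Suc l}) = Suc l" using card_image[OF inj] by simp
    ultimately show ?thesis
      unfolding signed_sums_def mem_Collect_eq using es(2) sub
      by (intro exI[of _ "set es"] exI[of _ "(!) es ` {..<Suc l}"] exI[of _ s]) (simp add: s_def)
  qed
  moreover have "x = (\<Sum>l<n. (a l - a (Suc l)) *\<^sub>R c l)"
  proof -
    have "x = (\<Sum>i<n. t (es ! i) *\<^sub>R (es ! i))"
      unfolding x using sum.reindex_bij_betw[OF bij_betw_nth[OF es(1) refl refl], of "\<lambda>c. t c *\<^sub>R c"] len
      by simp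
    also have "\<dots> = (\<Sum>i<n. a i *\<^sub>R (s (es ! i) *\<^sub>R (es ! i)))"
      using len by (intro sum.cong refl) (simp add: a_def ev s_def)
    also have "\<dots> = (\<Sum>l<n. (a l - a (Suc l)) *\<^sub>R (\<Sum>i<min n (Suc l). s (es ! i) *\<^sub>R (es ! i)))"
      by (rule abel_summation) (simp_all add: a_def)
    also have "\<dots> = (\<Sum>l<n. (a l - a (Suc l)) *\<^sub>R c l)"
    proof (intro sum.cong refl)
      fix l assume "l \<in> {..<n}"
      then have "min n (Suc l) = Suc l" by simp
      then show "(a l - a (Suc l)) *\<^sub>R (\<Sum>i<min n (Suc l). s (es ! i) *\<^sub>R (es ! i)) =
          (a l - a (Suc l)) *\<^sub>R c l" by (simp only: c_def)
    qed
    finally show ?thesis .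
  qed
  ultimately show ?thesis by blast
qed

text \<open>On a signed sum of \<open>m\<close> members, whose eigenvalues in absolute value are \<open>m\<close> ones followed by
zeros, the majorization is the stated inequality. Conversely, the inequality extends from
signed sums to their nonnegative combinations by sublinearity of \<open>ky_fan k\<close>, and summation by
parts turns the combined bounds back into the sum of the \<open>q\<^sub>i \<lambda>\<^sub>i(|x|)\<close>.\<close>

lemma majorant_iff_signed_sums:
  fixes T :: "'a::euclidean_jordan_algebra \<Rightarrow> 'a"
  defines "n \<equiv> jrank TYPE('a)"
  assumes trace_inner: "\<And>x y :: 'a. inner x y = jtrace (x * y)"
    and lin: "linear T" and q: "q \<in> nonneg_decreasing n"
  shows "(\<forall>x. eigenvalues (jabs (T x)) \<prec>\<^sub>w q \<star> eigenvalues (jabs x)) \<longleftrightarrow>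
    (\<forall>k\<le>n. \<forall>m\<le>n. \<forall>z\<in>signed_sums m. ky_fan k (T z) \<le> (\<Sum>i<min k m. q ! i))"
    (is "?L \<longleftrightarrow> ?R")
proof
  assume L: ?L
  show ?R
  proof (intro allI impI ballI)
    fix k m and z :: 'a
    assume km: "k \<le> n" "m \<le> n" and z: "z \<in> signed_sums m"
    have "ky_fan k (T z) \<le> (\<Sum>i<k. q ! i * eigenvalues (jabs z) ! i)"
      using L km(1) weakly_majorized_ky_fan q unfolding n_def by blast
    also have "\<dots> = (\<Sum>i<k. if i < m then q ! i else 0)"
      using km by (intro sum.cong refl) (simp add: eigenvalues_signed_sum[OF z] nth_append n_def)
    also have "\<dots> = (\<Sum>i<min k m. q ! i)"
      by (rule sum.mono_neutral_cong_right) auto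
    finally show "ky_fan k (T z) \<le> (\<Sum>i<min k m. q ! i)" .
  qed
next
  assume R: ?R
  show ?L
  proof
    fix x :: 'a
    define a where "a = (\<lambda>i. if i < n then eigenvalues (jabs x) ! i else 0)"
    obtain c where c: "\<And>l. l < n \<Longrightarrow> c l \<in> signed_sums (Suc l)"
      and x: "x = (\<Sum>l<n. (a l - a (Suc l)) *\<^sub>R c l)"
      using signed_sum_decomposition[of x] unfolding a_def n_def by blast
    have a: "0 \<le> a l - a (Suc l)" if "l < n" for l
      using eigenvalues_jabs_nonneg_decreasing[of x] that
      by (auto simp: a_def n_def nonneg_decreasing_iff sorted_wrt_iff_nth_less)
    have "ky_fan k (T x) \<le> (\<Sum>i<k. q ! i * eigenvalues (jabs x) ! i)" if k: "k \<le> n" for k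
    proof -
      have "T x = (\<Sum>l<n. (a l - a (Suc l)) *\<^sub>R T (c l))"
        by (subst x) (simp add: linear_sum[OF lin] linear_scale[OF lin])
      then have "ky_fan k (T x) \<le> (\<Sum>l<n. (a l - a (Suc l)) * ky_fan k (T (c l)))"
        using ky_fan_combination[OF trace_inner, of k "{..<n}" "\<lambda>l. a l - a (Suc l)" "\<lambda>l. T (c l)"]
          k a by (simp add: n_def)
      also have "\<dots> \<le> (\<Sum>l<n. (a l - a (Suc l)) * (\<Sum>i<min k (Suc l). q ! i))"
        using R k c a by (intro sum_mono mult_left_mono) auto
      also have "\<dots> = (\<Sum>i<k. a i * q ! i)"
        using abel_summation[OF k, of a "\<lambda>i. q ! i"] by (simp add: a_def)
      also have "\<dots> = (\<Sum>i<k. q ! i * eigenvalues (jabs x) ! i)"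
        using k by (intro sum.cong refl) (simp add: a_def)
      finally show ?thesis .
    qed
    then show "eigenvalues (jabs (T x)) \<prec>\<^sub>w q \<star> eigenvalues (jabs x)"
      using weakly_majorized_ky_fan q unfolding n_def by blast
  qed
qed

text \<open>A constant list with a large enough entry works: \<open>ky_fan k (T x)\<close> is bounded by a multiple of the
norm of \<open>x\<close>, and that by a multiple of the largest eigenvalue of \<open>|x|\<close>.\<close>

lemma majorant_exists:
  fixes T :: "'a::euclidean_jordan_algebra \<Rightarrow> 'a"
  defines "n \<equiv> jrank TYPE('a)"
  assumes trace_inner: "\<And>x y :: 'a. inner x y = jtrace (x * y)" and lin: "linear T"
  shows "\<exists>q\<in>nonneg_decreasing n. \<forall>x. eigenvalues (jabs (T x)) \<prec>\<^sub>w q \<star> eigenvalues (jabs x)"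
proof -
  obtain B where B: "0 < B" "\<And>x. norm (T x) \<le> norm x * B"
    using lin bounded_linear.pos_bounded linear_conv_bounded_linear by blast
  define C where "C = real n * (real n * B)"
  have C: "0 \<le> C" using B(1) by (simp add: C_def)
  have q: "replicate n C \<in> nonneg_decreasing n"
    using C by (simp add: nonneg_decreasing_iff sorted_wrt_iff_nth_less)
  have "ky_fan k (T x) \<le> (\<Sum>i<k. replicate n C ! i * eigenvalues (jabs x) ! i)" if k: "k \<le> n" for k x
  proof (cases "k = 0")
    case False
    have ev: "0 \<le> eigenvalues (jabs x) ! i" if "i < n" for i
      using eigenvalues_jabs_nonneg_decreasing[of x] that by (simp add: n_def nonneg_decreasing_iff)
    have "ky_fan k (T x) \<le> real k * norm (T x)"
      using ky_fan_le_norm[OF trace_inner] k by (simp add: n_def)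
    also have "\<dots> \<le> real n * (norm x * B)" using k B(2) by (intro mult_mono) auto
    also have "\<dots> \<le> real n * (real n * eigenvalues (jabs x) ! 0 * B)"
      using norm_le_max_eigenvalue[OF trace_inner, of x] B(1)
      by (intro mult_left_mono mult_right_mono) (auto simp: n_def)
    also have "\<dots> = (\<Sum>i\<in>{0}. replicate n C ! i * eigenvalues (jabs x) ! i)"
      using False k by (simp add: C_def)
    also have "\<dots> \<le> (\<Sum>i<k. replicate n C ! i * eigenvalues (jabs x) ! i)"
      using False k C ev by (intro sum_mono2) auto
    finally show ?thesis .
  qed (simp add: ky_fan_def)
  then show ?thesis using weakly_majorized_ky_fan q unfolding n_def by blast
qed

theorem theorem3p1:
  fixes T :: "'a::euclidean_jordan_algebra \<Rightarrow> 'a"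
    and n :: nat
  assumes rank: "jrank TYPE('a) = n"
    and trace_inner: "\<And>x y :: 'a. inner x y = jtrace (x * y)"
    and lin: "linear T"
  shows "\<exists>!\<eta>. \<eta> \<in> nonneg_decreasing n \<and>
    (\<forall>x. eigenvalues (jabs (T x)) \<prec>\<^sub>w \<eta> \<star> eigenvalues (jabs x)) \<and>
    (\<forall>q \<in> nonneg_decreasing n.
       (\<forall>x. eigenvalues (jabs (T x)) \<prec>\<^sub>w q \<star> eigenvalues (jabs x)) \<longrightarrow> \<eta> \<prec>\<^sub>w q)"
proof -
  define majorant where "majorant q \<longleftrightarrow> (\<forall>x. eigenvalues (jabs (T x)) \<prec>\<^sub>w q \<star> eigenvalues (jabs x))" for q
  define Q where "Q = {q \<in> nonneg_decreasing n. majorant q}"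
  have majorant_iff: "majorant q \<longleftrightarrow>
      (\<forall>k\<le>n. \<forall>m\<le>n. \<forall>z\<in>signed_sums m. ky_fan k (T z) \<le> (\<Sum>i<min k m. q ! i))"
    if "q \<in> nonneg_decreasing n" for q
    using majorant_iff_signed_sums[OF trace_inner lin, of q] that by (simp add: rank majorant_def)
  have prec_iff: "p \<prec>\<^sub>w q \<longleftrightarrow> (\<forall>k\<le>n. (\<Sum>i<k. p ! i) \<le> (\<Sum>i<k. q ! i))"
    if "p \<in> nonneg_decreasing n" "q \<in> nonneg_decreasing n" for p q
    using that weakly_majorized_decreasing_iff[of p n q] by (simp add: nonneg_decreasing_iff sum_list_take_nth)
  have "Q \<noteq> {}"
    using majorant_exists[OF trace_inner lin] by (auto simp: rank Q_def majorant_def)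
  moreover have "Q \<subseteq> nonneg_decreasing n" by (auto simp: Q_def)
  ultimately obtain \<eta> where \<eta>: "\<eta> \<in> nonneg_decreasing n"
    and least: "\<And>k q. k \<le> n \<Longrightarrow> q \<in> Q \<Longrightarrow> (\<Sum>i<k. \<eta> ! i) \<le> (\<Sum>i<k. q ! i)"
    and greatest: "\<And>k b. k \<le> n \<Longrightarrow> (\<And>q. q \<in> Q \<Longrightarrow> b \<le> (\<Sum>i<k. q ! i)) \<Longrightarrow> b \<le> (\<Sum>i<k. \<eta> ! i)"
    using least_concave_partial_sums[of Q n] by metis
  have "majorant \<eta>"
    unfolding majorant_iff[OF \<eta>]
  proof (intro allI impI ballI)
    fix k m and z :: 'a
    assume km: "k \<le> n" "m \<le> n" and z: "z \<in> signed_sums m"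
    have "ky_fan k (T z) \<le> (\<Sum>i<min k m. q ! i)" if "q \<in> Q" for q
      using that majorant_iff[of q] km z by (simp add: Q_def)
    \<comment> \<open>the bound concerns a single partial sum, so it passes to the infimum\<close>
    then show "ky_fan k (T z) \<le> (\<Sum>i<min k m. \<eta> ! i)" using km by (intro greatest) auto
  qed
  moreover have "\<eta> \<prec>\<^sub>w q" if "q \<in> nonneg_decreasing n" "majorant q" for q
    using that least unfolding prec_iff[OF \<eta> that(1)] by (simp add: Q_def)
  moreover have "p = \<eta>"
    if p: "p \<in> nonneg_decreasing n" and "p \<prec>\<^sub>w \<eta>" "\<eta> \<prec>\<^sub>w p" for p
  proof (rule nth_equalityI)
    show len: "length p = length \<eta>" using p \<eta> by (simp add: nonneg_decreasing_iff)
    have eq: "(\<Sum>i<k. p ! i) = (\<Sum>i<k. \<eta> ! i)" if "k \<le> n" for k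
      using \<open>p \<prec>\<^sub>w \<eta>\<close> \<open>\<eta> \<prec>\<^sub>w p\<close> that unfolding prec_iff[OF p \<eta>] prec_iff[OF \<eta> p]
      by (simp add: antisym)
    fix i assume "i < length p"
    then have "i < n" using p by (simp add: nonneg_decreasing_iff)
    then show "p ! i = \<eta> ! i" using eq[of i] eq[of "Suc i"] by simp
  qed
  ultimately show ?thesis unfolding majorant_def[symmetric] using \<eta> by (intro ex1I[of _ \<eta>]) blast+
qed

end
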